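(* Let $p,q>1$, $A>0$, $B>0$, $R\ge 1$, and let $f\in C_0^2(\mathbf{R})$, $g\in C_0^1(\mathbf{R})$ be real-valued functions with $\operatorname{supp} f,\ \operatorname{supp} g\subset\{x\in\mathbf{R}:|x|\le R\}$. Assume $$\int_{\mathbf{R}}g(x)\,dx= 0.$$ Then there exist a positive constant $\varepsilon_2=\varepsilon_2(f,g,p,q,A,B,R)>0$ and a positive constant $c$ independent of $\varepsilon$ such that, for every $\varepsilon$ with $0<\varepsilon\le\varepsilon_2$, a classical solution $u\in C^2(\mathbf{R}\times[0,T])$ of the initial value problem $$u_{tt}-u_{xx}=A|u_t|^p+B|u|^q,\qquad u(x,0)=\varepsilon f(x),\quad u_t(x,0)=\varepsilon g(x)\quad(x\in\mathbf{R})$$ exists on $\mathbf{R}\times[0,T]$ as long as $T>0$ satisfies $$T\le\begin{cases} c\,\varepsilon^{-(p-1)} & \text{for } p\le \dfrac{q+1}{2},\\[2mm] c\,\varepsilon^{-p(q-1)/(q+1)} & \text{for } \dfrac{q+1}{2}\le p\le q,\\[2mm] c\,\varepsilon^{-q(q-1)/(q+1)} & \text{for } p\ge q.\end{cases}$$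
   Context: Here $C_0^k(\mathbf{R})$ denotes the space of $k$ times continuously differentiable functions on $\mathbf{R}$ with compact support. A classical solution on $\mathbf{R}\times[0,T]$ is a real-valued function $u=u(x,t)$ of class $C^2$ on $\mathbf{R}\times[0,T]$ satisfying the equation there and the initial conditions at $t=0$. *)

theory Defs
  imports "HOL-Analysis.Analysis"
begin

definition supp :: "(real \<Rightarrow> real) \<Rightarrow> real set" where
  "supp f = closure (support_on UNIV f)"

definition C_k :: "nat \<Rightarrow> (real \<Rightarrow> real) \<Rightarrow> bool" where
  "C_k k f \<longleftrightarrow>
     (\<forall>i<k. (deriv ^^ i) f differentiable_on UNIV) \<and> continuous_on UNIV ((deriv ^^ k) f)"

definition C_k_compact_support :: "nat \<Rightarrow> (real \<Rightarrow> real) \<Rightarrow> bool" where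
  "C_k_compact_support k f \<longleftrightarrow> C_k k f \<and> compact (supp f)"

(* Functions u = u(x,t) on the strip R x [0,T] are curried, space variable first. *)

definition dx :: "(real \<Rightarrow> real \<Rightarrow> real) \<Rightarrow> real \<Rightarrow> real \<Rightarrow> real" where
  "dx u x t = deriv (\<lambda>y. u y t) x"

(* The time derivative is taken within [0,T], hence one-sided at t = 0 and t = T,
   so values of u outside the strip play no role. It is only meaningful for T > 0. *)
definition dt :: "real \<Rightarrow> (real \<Rightarrow> real \<Rightarrow> real) \<Rightarrow> real \<Rightarrow> real \<Rightarrow> real" where
  "dt T u x t = vector_derivative (\<lambda>s. u x s) (at t within {0..T})"

(* Class C^k on the closed strip R x [0,T]: all partial derivatives up to order k, in every
   order of differentiation, exist and are jointly continuous on R x [0,T]. *)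
primrec C_k_strip :: "nat \<Rightarrow> real \<Rightarrow> (real \<Rightarrow> real \<Rightarrow> real) \<Rightarrow> bool" where
  "C_k_strip 0 T u \<longleftrightarrow> continuous_on (UNIV \<times> {0..T}) (\<lambda>(x, t). u x t)"
| "C_k_strip (Suc k) T u \<longleftrightarrow>
     continuous_on (UNIV \<times> {0..T}) (\<lambda>(x, t). u x t) \<and>
     (\<forall>x. \<forall>t\<in>{0..T}. (\<lambda>y. u y t) differentiable (at x)) \<and>
     (\<forall>x. \<forall>t\<in>{0..T}. (\<lambda>s. u x s) differentiable (at t within {0..T})) \<and>
     C_k_strip k T (dx u) \<and> C_k_strip k T (dt T u)"

(* The initial value problem
     u_tt - u_xx = A |u_t|^p + B |u|^q,   u(x,0) = u0(x),   u_t(x,0) = u1(x). *)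
definition classical_solution ::
  "real \<Rightarrow> real \<Rightarrow> real \<Rightarrow> real \<Rightarrow> (real \<Rightarrow> real) \<Rightarrow> (real \<Rightarrow> real) \<Rightarrow> real \<Rightarrow>
   (real \<Rightarrow> real \<Rightarrow> real) \<Rightarrow> bool" where
  "classical_solution p q A B u0 u1 T u \<longleftrightarrow>
     C_k_strip 2 T u \<and>
     (\<forall>x. \<forall>t\<in>{0..T}. dt T (dt T u) x t - dx (dx u) x t
                      = A * \<bar>dt T u x t\<bar> powr p + B * \<bar>u x t\<bar> powr q) \<and>
     (\<forall>x. u x 0 = u0 x) \<and>
     (\<forall>x. dt T u x 0 = u1 x)"

end

theory Submission
  imports Defs
begin

text \<open>
  Since \<open>g\<close> has mean zero, the free solution consists of two compactly supported travelling profiles,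
  so it lives only near the light cone \<open>\<bar>x\<bar> = t\<close> (Huygens' principle), where it has size \<open>\<epsilon>\<close>.
  Take the source \<open>F = A \<bar>u\<^sub>t\<bar>\<^sup>p + B \<bar>u\<bar>\<^sup>q\<close> as the unknown; Duhamel's formula turns the problem into
  a Volterra fixed point equation for \<open>F\<close>. With \<open>m = min p q\<close>, the Picard iterates keep \<open>F\<close> of size
  \<open>\<epsilon>\<^sup>m\<close> near the light cone, which makes \<open>u\<^sub>t\<close> of size \<open>\<epsilon>\<^sup>m\<close> and \<open>u\<close> of size \<open>T \<epsilon>\<^sup>m\<close> in the
  interior. These bounds reproduce themselves as long as \<open>T * \<epsilon> powr (m - 1)\<close> and
  \<open>T * \<epsilon> powr (m * (q - 1) / (q + 1))\<close> are small, which covers the three regimes.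
  The uniform bounds make the iteration a contraction in a norm weighted by \<open>exp (\<mu> t)\<close>. Because
  \<open>p\<close> and \<open>q\<close> are only assumed to exceed \<open>1\<close>, the \<open>x\<close>-derivatives of the iterates satisfy just a
  contraction estimate up to a vanishing error, which is still enough for uniform convergence and
  hence for \<open>C\<^sup>2\<close> regularity.
\<close>

subsection \<open>Integration along characteristics\<close>

text \<open>The two exponents come from two lengths. Near the cone a characteristic can run
  alongside the strip during all of \<open>[0, T]\<close>, so a source of size
  \<open>\<delta>\<close>, comparable to \<open>\<epsilon> powr m\<close>, may change
  \<open>u_t\<close> by \<open>T * \<delta>\<close>; keeping this below \<open>\<epsilon>\<close>
  asks that \<open>T * \<epsilon> powr (m - 1)\<close> be small. A characteristic ending in the
  interior crosses the strip within time \<open>R\<close> and collects only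
  \<open>R * \<delta>\<close> there, independently of \<open>T\<close>. This suggests the interior
  sizes \<open>N = 2 * R * \<delta>\<close> for \<open>u_t\<close> and \<open>2 * T * N\<close> for
  \<open>u\<close>, and leaves \<open>N / 2\<close> for the interior source:
  \<open>T * (A * N powr p + B * (2 * T * N) powr q) \<le> N / 2\<close>. The \<open>p\<close> term
  follows from the first condition because \<open>m * (p - 1) \<ge> m - 1\<close>; the
  \<open>q\<close> term asks that \<open>T powr (q + 1) * \<epsilon> powr (m * (q - 1))\<close> be
  small, which is the second condition. As for regularity, the derivative of
  \<open>\<bar>s\<bar> powr p\<close> is continuous but not Lipschitz near 0 when
  \<open>p < 2\<close>. Second derivatives of a Duhamel integral involve only \<open>F\<close> and
  its \<open>x\<close>-derivative, so a continuously differentiable nonlinearity is enough and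
  \<open>F\<close> is never differentiated in time.\<close>

definition strip_continuous :: "real \<Rightarrow> (real \<Rightarrow> real \<Rightarrow> real) \<Rightarrow> bool" where
  "strip_continuous T F \<longleftrightarrow> continuous_on (UNIV \<times> {0..T}) (\<lambda>(x, t). F x t)"

definition has_x_derivative ::
  "real \<Rightarrow> (real \<Rightarrow> real \<Rightarrow> real) \<Rightarrow> (real \<Rightarrow> real \<Rightarrow> real) \<Rightarrow> bool" where
  "has_x_derivative T F F' \<longleftrightarrow>
     (\<forall>x. \<forall>t\<in>{0..T}. ((\<lambda>y. F y t) has_real_derivative F' x t) (at x))"

definition has_t_derivative ::
  "real \<Rightarrow> (real \<Rightarrow> real \<Rightarrow> real) \<Rightarrow> (real \<Rightarrow> real \<Rightarrow> real) \<Rightarrow> bool" where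
  "has_t_derivative T F F' \<longleftrightarrow>
     (\<forall>x. \<forall>t\<in>{0..T}. ((\<lambda>s. F x s) has_real_derivative F' x t) (at t within {0..T}))"

text \<open>The path runs backwards from \<open>(x, t)\<close> along a characteristic for
  \<open>\<sigma> = 1\<close> and \<open>\<sigma> = - 1\<close>, and along a vertical line for
  \<open>\<sigma> = 0\<close>; one set of lemmas thus covers Duhamel terms and plain time
  integrals.\<close>

definition char_int :: "real \<Rightarrow> (real \<Rightarrow> real \<Rightarrow> real) \<Rightarrow> real \<Rightarrow> real \<Rightarrow> real" where
  "char_int \<sigma> F x t = integral {0..t} (\<lambda>s. F (x + \<sigma> * (t - s)) s)"

lemma strip_continuous_compose:
  assumes "strip_continuous T F" "continuous_on U X" "continuous_on U S"
    and "\<And>z. z \<in> U \<Longrightarrow> S z \<in> {0..T}"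
  shows "continuous_on U (\<lambda>z. F (X z) (S z))"
proof -
  have "continuous_on U (\<lambda>z. (\<lambda>(x, t). F x t) (X z, S z))"
    using assms(1) unfolding strip_continuous_def
    by (rule continuous_on_compose2) (use assms in \<open>auto intro!: continuous_intros\<close>)
  then show ?thesis by simp
qed

lemma strip_continuousI:
  assumes "continuous_on (UNIV \<times> {0..T}) (\<lambda>z. F (fst z) (snd z))"
  shows "strip_continuous T F"
  using assms by (simp add: strip_continuous_def case_prod_unfold)

lemma strip_continuousD:
  assumes "strip_continuous T F"
  shows "continuous_on (UNIV \<times> {0..T}) (\<lambda>z. F (fst z) (snd z))"
  using assms by (simp add: strip_continuous_def case_prod_unfold)

lemma char_int_integrand_continuous:
  assumes "strip_continuous T F" "t \<in> {0..T}"
  shows "continuous_on {0..t} (\<lambda>s. F (x + \<sigma> * (t - s)) s)"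
  by (rule strip_continuous_compose[OF assms(1)]) (use assms in \<open>auto intro!: continuous_intros\<close>)

lemma char_int_integrable:
  assumes "strip_continuous T F" "t \<in> {0..T}"
  shows "(\<lambda>s. F (x + \<sigma> * (t - s)) s) integrable_on {0..t}"
  using char_int_integrand_continuous[OF assms] by (rule integrable_continuous_real)

text \<open>Continuity of parameter integrals is available for a fixed domain of integration; the
  substitution \<open>s = t * r\<close> provides one.\<close>

lemma char_int_unit_interval:
  assumes "strip_continuous T F" "t \<in> {0..T}"
  shows "char_int \<sigma> F x t = integral (cbox 0 1) (\<lambda>r. t * F (x + \<sigma> * (t - t * r)) (t * r))"
proof (cases "t = 0")
  case True
  then show ?thesis by (simp add: char_int_def)
next
  case False
  then have t: "t > 0" using assms by auto
  have im: "(\<lambda>r. r / t) ` {0..t} = {0..1}"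
  proof
    show "{0..1} \<subseteq> (\<lambda>r. r / t) ` {0..t}"
    proof
      fix r :: real assume r: "r \<in> {0..1}"
      then have "r = (t * r) / t" "t * r \<in> {0..t}"
        using t by (auto simp: mult_left_le)
      then show "r \<in> (\<lambda>r. r / t) ` {0..t}" by blast
    qed
  qed (use t in auto)
  have "((\<lambda>s. F (x + \<sigma> * (t - s)) s) has_integral char_int \<sigma> F x t) {0..t}"
    unfolding char_int_def by (intro integrable_integral char_int_integrable[OF assms])
  from has_integral_stretch_real[OF this False]
  have "((\<lambda>r. F (x + \<sigma> * (t - t * r)) (t * r)) has_integral char_int \<sigma> F x t / t) {0..1}"
    using t by (simp add: im)
  from has_integral_mult_right[OF this, of t]
  have "((\<lambda>r. t * F (x + \<sigma> * (t - t * r)) (t * r)) has_integral char_int \<sigma> F x t) {0..1}"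
    using t by simp
  then show ?thesis unfolding box_real by (rule integral_unique[symmetric])
qed

lemma strip_continuous_char_int:
  assumes "strip_continuous T F"
  shows "strip_continuous T (char_int \<sigma> F)"
proof -
  have "continuous_on (UNIV \<times> {0..T})
      (\<lambda>z. integral (cbox 0 1) (\<lambda>r. snd z * F (fst z + \<sigma> * (snd z - snd z * r)) (snd z * r)))"
  proof (rule integral_continuous_on_param)
    have "continuous_on ((UNIV \<times> {0..T}) \<times> cbox 0 1)
        (\<lambda>w. F (fst (fst w) + \<sigma> * (snd (fst w) - snd (fst w) * snd w)) (snd (fst w) * snd w))"
    proof (rule strip_continuous_compose[OF assms])
      show "snd (fst w) * snd w \<in> {0..T}" if "w \<in> (UNIV \<times> {0..T}) \<times> cbox 0 1"
        for w :: "(real \<times> real) \<times> real"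
      proof -
        have w: "0 \<le> snd (fst w)" "snd (fst w) \<le> T" "0 \<le> snd w" "snd w \<le> 1" using that by auto
        then have "snd (fst w) * snd w \<le> snd (fst w)" by (simp add: mult_left_le)
        with w show ?thesis by auto
      qed
    qed (intro continuous_intros)+
    then show "continuous_on ((UNIV \<times> {0..T}) \<times> cbox 0 1)
        (\<lambda>(z, r). snd z * F (fst z + \<sigma> * (snd z - snd z * r)) (snd z * r))"
      unfolding case_prod_unfold by (intro continuous_intros)
  qed
  then have "continuous_on (UNIV \<times> {0..T}) (\<lambda>z. char_int \<sigma> F (fst z) (snd z))"
    by (rule continuous_on_cong[THEN iffD2, rotated -1])
       (rule refl, rule char_int_unit_interval[OF assms], auto)
  then show ?thesis by (rule strip_continuousI)
qed

lemma has_x_derivative_char_int: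
  assumes "strip_continuous T F" "strip_continuous T F'" "has_x_derivative T F F'"
  shows "has_x_derivative T (char_int \<sigma> F) (char_int \<sigma> F')"
  unfolding has_x_derivative_def
proof (intro allI ballI)
  fix x t assume t: "t \<in> {0..T}"
  have "((\<lambda>y. integral (cbox 0 t) (\<lambda>s. F (y + \<sigma> * (t - s)) s)) has_field_derivative
      integral (cbox 0 t) (\<lambda>s. F' (x + \<sigma> * (t - s)) s)) (at x within UNIV)"
  proof (rule leibniz_rule_field_derivative)
    show "((\<lambda>y. F (y + \<sigma> * (t - s)) s) has_real_derivative F' (y + \<sigma> * (t - s)) s) (at y within UNIV)"
      if "s \<in> cbox 0 t" for y s
    proof -
      have "((\<lambda>y. F y s) has_real_derivative F' (y + \<sigma> * (t - s)) s) (at (y + \<sigma> * (t - s)))"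
        using assms(3) that t unfolding has_x_derivative_def by auto
      then have "((\<lambda>y. F (y + \<sigma> * (t - s)) s) has_real_derivative F' (y + \<sigma> * (t - s)) s) (at y)"
        by (subst (asm) DERIV_shift)
      then show ?thesis by simp
    qed
    show "(\<lambda>s. F (y + \<sigma> * (t - s)) s) integrable_on cbox 0 t" for y
      using char_int_integrable[OF assms(1) t] by simp
    show "continuous_on (UNIV \<times> cbox 0 t) (\<lambda>(y, s). F' (y + \<sigma> * (t - s)) s)"
      unfolding case_prod_unfold
      by (rule strip_continuous_compose[OF assms(2)]) (use t in \<open>auto intro!: continuous_intros\<close>)
  qed auto
  then show "((\<lambda>y. char_int \<sigma> F y t) has_real_derivative char_int \<sigma> F' x t) (at x)"
    by (simp add: char_int_def)
qed

text \<open>Time enters both the upper limit and the integrand. In the characteristic coordinate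
  \<open>y = x + \<sigma> * t\<close> it leaves the integrand, so the two effects become partial
  derivatives of \<open>\<Phi>\<close>, recombined by the chain rule along \<open>s\<close> to
  \<open>(s, x + \<sigma> * s)\<close>.\<close>

lemma has_t_derivative_char_int:
  assumes "strip_continuous T F" "strip_continuous T F'" "has_x_derivative T F F'"
  shows "has_t_derivative T (char_int \<sigma> F) (\<lambda>x t. F x t + \<sigma> * char_int \<sigma> F' x t)"
  unfolding has_t_derivative_def
proof (intro allI ballI)
  fix x t assume t: "t \<in> {0..T}"
  define \<Phi> where "\<Phi> s y = integral {0..s} (\<lambda>r. F (y - \<sigma> * r) r)" for s y
  define c where "c s y = char_int \<sigma> F' (y - \<sigma> * s) s" for s y
  have char: "char_int \<sigma> F y s = \<Phi> s (y + \<sigma> * s)" for y s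
    by (simp add: char_int_def \<Phi>_def algebra_simps)
  have \<Phi>: "\<Phi> s y = char_int \<sigma> F (y - \<sigma> * s) s" for y s
    by (simp add: char)
  let ?y = "x + \<sigma> * t"
  have "((\<lambda>(s, y). \<Phi> s y) has_derivative
      (\<lambda>(hs, hy). F (?y - \<sigma> * t) t * hs + blinfun_mult_right (c t ?y) hy))
      (at (t, ?y) within {0..T} \<times> UNIV)"
  proof (rule has_derivative_partialsI)
    have "continuous_on {0..T} (\<lambda>r. F (?y - \<sigma> * r) r)"
      by (rule strip_continuous_compose[OF assms(1)]) (auto intro!: continuous_intros)
    from integral_has_real_derivative[OF this t]
    show "((\<lambda>s. \<Phi> s ?y) has_derivative (*) (F (?y - \<sigma> * t) t)) (at t within {0..T})"
      by (simp add: \<Phi>_def has_field_derivative_def)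
    show "((\<lambda>y. \<Phi> s y) has_derivative blinfun_mult_right (c s y)) (at y within UNIV)"
      if "s \<in> {0..T}" for s y
    proof -
      have "((\<lambda>y. char_int \<sigma> F y s) has_real_derivative c s y) (at (y - \<sigma> * s))"
        using has_x_derivative_char_int[OF assms, of \<sigma>] that
        unfolding has_x_derivative_def c_def by auto
      then have "((\<lambda>y. char_int \<sigma> F (y + (- (\<sigma> * s))) s) has_real_derivative c s y) (at y)"
        by (subst DERIV_shift[symmetric]) simp
      then show ?thesis
        by (simp add: \<Phi> has_field_derivative_def)
    qed
    have "continuous_on ({0..T} \<times> UNIV) (\<lambda>z. c (fst z) (snd z))"
      unfolding c_def
      by (rule strip_continuous_compose[OF strip_continuous_char_int[OF assms(2)]])
         (auto intro!: continuous_intros)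
    then have "continuous_on ({0..T} \<times> UNIV) (\<lambda>(s, y). blinfun_mult_right (c s y))"
      unfolding case_prod_unfold by (intro continuous_intros)
    then show "continuous (at (t, ?y) within {0..T} \<times> UNIV) (\<lambda>(s, y). blinfun_mult_right (c s y))"
      using t unfolding continuous_on_eq_continuous_within by blast
  qed auto
  then have "((\<lambda>(s, y). \<Phi> s y) has_derivative
      (\<lambda>(hs, hy). F (?y - \<sigma> * t) t * hs + blinfun_mult_right (c t ?y) hy))
      (at (t, ?y) within (\<lambda>s. (s, x + \<sigma> * s)) ` {0..T})"
    by (rule has_derivative_subset) auto
  moreover have "((\<lambda>s. (s, x + \<sigma> * s)) has_derivative (\<lambda>h. (h, \<sigma> * h))) (at t within {0..T})"
    by (auto intro!: derivative_eq_intros)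
  ultimately have "((\<lambda>s. char_int \<sigma> F x s) has_derivative (\<lambda>h. F x t * h + c t ?y * (\<sigma> * h)))
      (at t within {0..T})"
    unfolding char using has_derivative_in_compose by fastforce
  moreover have "(\<lambda>h. F x t * h + c t ?y * (\<sigma> * h)) = (*) (F x t + \<sigma> * char_int \<sigma> F' x t)"
    by (auto simp: c_def algebra_simps)
  ultimately show "((\<lambda>s. char_int \<sigma> F x s) has_real_derivative F x t + \<sigma> * char_int \<sigma> F' x t)
      (at t within {0..T})"
    by (simp add: has_field_derivative_def)
qed

lemma char_int_diff:
  assumes "strip_continuous T F" "strip_continuous T G" "t \<in> {0..T}"
  shows "char_int \<sigma> (\<lambda>x t. F x t - G x t) x t = char_int \<sigma> F x t - char_int \<sigma> G x t"
  unfolding char_int_def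
  by (rule integral_diff) (rule char_int_integrable[OF _ assms(3)], rule assms)+

text \<open>Integrating the weight gains a factor \<open>1 / \<mu>\<close> whatever the size of
  \<open>T\<close>; a large \<open>\<mu>\<close> thus replaces a short time in the contraction
  argument.\<close>

lemma char_int_exp_bound:
  assumes F: "strip_continuous T F" and t: "t \<in> {0..T}" and \<mu>: "\<mu> > 0" and C: "C \<ge> 0"
    and bound: "\<And>x t. t \<in> {0..T} \<Longrightarrow> \<bar>F x t\<bar> \<le> C * exp (\<mu> * t)"
  shows "\<bar>char_int \<sigma> F x t\<bar> \<le> C / \<mu> * exp (\<mu> * t)"
proof -
  have *: "((\<lambda>s. C * exp (\<mu> * s)) has_integral C / \<mu> * exp (\<mu> * t) - C / \<mu> * exp (\<mu> * 0)) {0..t}"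
    using t \<mu>
    by (intro fundamental_theorem_of_calculus)
       (auto intro!: derivative_eq_intros simp flip: has_real_derivative_iff_has_vector_derivative)
  have "norm (char_int \<sigma> F x t) \<le> integral {0..t} (\<lambda>s. C * exp (\<mu> * s))"
    unfolding char_int_def
    by (rule integral_norm_bound_integral)
       (use char_int_integrable[OF F t] * bound t in \<open>auto simp: has_integral_integrable\<close>)
  also have "\<dots> = C / \<mu> * exp (\<mu> * t) - C / \<mu>"
    using integral_unique[OF *] by simp
  also have "\<dots> \<le> C / \<mu> * exp (\<mu> * t)" using C \<mu> by simp
  finally show ?thesis by simp
qed

section \<open>Duhamel's formula with zero initial data\<close>

definition wave_t :: "(real \<Rightarrow> real \<Rightarrow> real) \<Rightarrow> real \<Rightarrow> real \<Rightarrow> real" where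
  "wave_t F x t = (char_int 1 F x t + char_int (- 1) F x t) / 2"

definition wave_x :: "(real \<Rightarrow> real \<Rightarrow> real) \<Rightarrow> real \<Rightarrow> real \<Rightarrow> real" where
  "wave_x F x t = (char_int 1 F x t - char_int (- 1) F x t) / 2"

text \<open>This equals half the integral of \<open>F\<close> over the backward triangle. Written as
  a time integral of \<open>wave_t F\<close>, it inherits bounds from \<open>wave_t\<close> along
  vertical lines.\<close>

definition wave :: "(real \<Rightarrow> real \<Rightarrow> real) \<Rightarrow> real \<Rightarrow> real \<Rightarrow> real" where
  "wave F = char_int 0 (wave_t F)"

lemma strip_continuous_wave_t:
  assumes "strip_continuous T F" shows "strip_continuous T (wave_t F)"
  using strip_continuous_char_int[OF assms, THEN strip_continuousD]
  by (intro strip_continuousI) (auto simp: wave_t_def intro!: continuous_intros)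

lemma strip_continuous_wave_x:
  assumes "strip_continuous T F" shows "strip_continuous T (wave_x F)"
  using strip_continuous_char_int[OF assms, THEN strip_continuousD]
  by (intro strip_continuousI) (auto simp: wave_x_def intro!: continuous_intros)

lemma strip_continuous_wave:
  assumes "strip_continuous T F" shows "strip_continuous T (wave F)"
  unfolding wave_def by (intro strip_continuous_char_int strip_continuous_wave_t assms)

lemma wave_t_diff:
  assumes "strip_continuous T F" "strip_continuous T G" "t \<in> {0..T}"
  shows "wave_t (\<lambda>x t. F x t - G x t) x t = wave_t F x t - wave_t G x t"
  by (simp add: wave_t_def char_int_diff[OF assms] field_simps)

lemma wave_diff:
  assumes "strip_continuous T F" "strip_continuous T G" "t \<in> {0..T}"
  shows "wave (\<lambda>x t. F x t - G x t) x t = wave F x t - wave G x t"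
proof -
  have "wave (\<lambda>x t. F x t - G x t) x t = char_int 0 (\<lambda>x t. wave_t F x t - wave_t G x t) x t"
    unfolding wave_def char_int_def
    by (rule integral_cong) (use assms in \<open>auto intro!: wave_t_diff\<close>)
  then show ?thesis
    by (simp add: wave_def char_int_diff[OF assms(1,2)[THEN strip_continuous_wave_t] assms(3)])
qed

lemma wave_t_exp_bound:
  assumes "strip_continuous T F" "t \<in> {0..T}" "\<mu> > 0" "C \<ge> 0"
    and "\<And>x t. t \<in> {0..T} \<Longrightarrow> \<bar>F x t\<bar> \<le> C * exp (\<mu> * t)"
  shows "\<bar>wave_t F x t\<bar> \<le> C / \<mu> * exp (\<mu> * t)"
proof -
  have average: "\<bar>(a + b) / 2\<bar> \<le> B" if "\<bar>a\<bar> \<le> B" "\<bar>b\<bar> \<le> B" for a b B :: real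
    using that by (simp add: abs_le_iff)
  show ?thesis
    unfolding wave_t_def
    by (intro average char_int_exp_bound[OF assms(1-4)] assms(5))
qed

text \<open>Two integrations would gain \<open>1 / \<mu>\<close> twice; one factor is given away so
  that \<open>wave\<close> and \<open>wave_t\<close> obey the same estimate.\<close>

lemma wave_exp_bound:
  assumes "strip_continuous T F" "t \<in> {0..T}" "\<mu> \<ge> 1" "C \<ge> 0"
    and "\<And>x t. t \<in> {0..T} \<Longrightarrow> \<bar>F x t\<bar> \<le> C * exp (\<mu> * t)"
  shows "\<bar>wave F x t\<bar> \<le> C / \<mu> * exp (\<mu> * t)"
proof -
  have "\<bar>wave F x t\<bar> \<le> (C / \<mu>) / \<mu> * exp (\<mu> * t)"
    unfolding wave_def
  proof (rule char_int_exp_bound[OF strip_continuous_wave_t[OF assms(1)] assms(2)])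
    show "\<bar>wave_t F x t\<bar> \<le> C / \<mu> * exp (\<mu> * t)" if "t \<in> {0..T}" for x t
      using assms(3) by (intro wave_t_exp_bound[OF assms(1) that _ assms(4,5)]) auto
  qed (use assms in auto)
  also have "(C / \<mu>) / \<mu> \<le> C / \<mu>"
    using assms by (simp add: divide_le_eq mult_le_cancel_left1 divide_less_0_iff)
  finally show ?thesis by simp
qed

lemma has_x_derivative_wave_t:
  assumes "strip_continuous T F" "strip_continuous T F'" "has_x_derivative T F F'"
  shows "has_x_derivative T (wave_t F) (wave_t F')"
  using has_x_derivative_char_int[OF assms]
  unfolding has_x_derivative_def wave_t_def by (auto intro!: derivative_intros DERIV_cdivide)

lemma has_x_derivative_wave_x:
  assumes "strip_continuous T F" "strip_continuous T F'" "has_x_derivative T F F'"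
  shows "has_x_derivative T (wave_x F) (wave_x F')"
  using has_x_derivative_char_int[OF assms]
  unfolding has_x_derivative_def wave_x_def by (auto intro!: derivative_intros DERIV_cdivide)

lemma has_x_derivative_wave':
  assumes "strip_continuous T F" "strip_continuous T F'" "has_x_derivative T F F'"
  shows "has_x_derivative T (wave F) (wave F')"
  unfolding wave_def
  by (intro has_x_derivative_char_int strip_continuous_wave_t has_x_derivative_wave_t assms)

lemma has_t_derivative_wave:
  assumes "strip_continuous T F" "strip_continuous T F'" "has_x_derivative T F F'"
  shows "has_t_derivative T (wave F) (wave_t F)"
  using has_t_derivative_char_int[OF strip_continuous_wave_t strip_continuous_wave_t
      has_x_derivative_wave_t[OF assms], of 0] assms
  by (simp add: wave_def)

lemma has_t_derivative_wave_t:
  assumes "strip_continuous T F" "strip_continuous T F'" "has_x_derivative T F F'"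
  shows "has_t_derivative T (wave_t F) (\<lambda>x t. F x t + wave_x F' x t)"
  using has_t_derivative_char_int[OF assms, of 1] has_t_derivative_char_int[OF assms, of "- 1"]
  unfolding has_t_derivative_def wave_t_def wave_x_def
  by (auto intro!: derivative_eq_intros simp: field_simps)

lemma has_t_derivative_wave_x:
  assumes "strip_continuous T F" "strip_continuous T F'" "has_x_derivative T F F'"
  shows "has_t_derivative T (wave_x F) (wave_t F')"
  using has_t_derivative_char_int[OF assms, of 1] has_t_derivative_char_int[OF assms, of "- 1"]
  unfolding has_t_derivative_def wave_t_def wave_x_def
  by (auto intro!: derivative_eq_intros simp: field_simps)

text \<open>Both sides vanish at time 0 and have time derivative \<open>wave_t F'\<close>. The form
  \<open>wave_x F\<close> can be differentiated in \<open>x\<close> once more without a second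
  derivative of \<open>F\<close>.\<close>

lemma wave_x_eq:
  assumes "strip_continuous T F" "strip_continuous T F'" "has_x_derivative T F F'" "t \<in> {0..T}"
  shows "wave F' x t = wave_x F x t"
proof -
  have "(wave_t F' x has_integral wave_x F x t - wave_x F x 0) {0..t}"
  proof (rule fundamental_theorem_of_calculus)
    fix s assume "s \<in> {0..t}"
    then have "(wave_x F x has_real_derivative wave_t F' x s) (at s within {0..T})"
      using has_t_derivative_wave_x[OF assms(1-3)] assms(4) unfolding has_t_derivative_def by auto
    then have "(wave_x F x has_real_derivative wave_t F' x s) (at s within {0..t})"
      by (rule DERIV_subset) (use assms in auto)
    then show "(wave_x F x has_vector_derivative wave_t F' x s) (at s within {0..t})"
      by (simp add: has_real_derivative_iff_has_vector_derivative)
  qed (use assms in auto)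
  then show ?thesis
    by (simp add: wave_def char_int_def wave_x_def integral_unique)
qed

lemma has_x_derivative_wave:
  assumes "strip_continuous T F" "strip_continuous T F'" "has_x_derivative T F F'"
  shows "has_x_derivative T (wave F) (wave_x F)"
  using has_x_derivative_wave'[OF assms] wave_x_eq[OF assms]
  unfolding has_x_derivative_def by auto

subsection \<open>Convergence of the Picard iteration\<close>

text \<open>\<open>P n m C\<close> stands for: iterates \<open>n\<close> and \<open>m\<close> are at
  distance at most \<open>C\<close>. Past some index the bound goes from \<open>C\<close> to
  \<open>C / 2 + \<eta> / 4\<close>, a map with fixed point \<open>\<eta> / 2\<close>, so
  \<open>k\<close> steps from \<open>C0\<close> lead to
  \<open>C0 / 2 ^ k + \<eta> / 2\<close>.\<close>

lemma contraction_with_vanishing_error: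
  fixes P :: "nat \<Rightarrow> nat \<Rightarrow> real \<Rightarrow> bool"
  assumes mono: "\<And>n m C D. P n m C \<Longrightarrow> C \<le> D \<Longrightarrow> P n m D"
    and start: "\<And>n m. P n m C0" and "C0 \<ge> 0"
    and step: "\<And>\<eta>. \<eta> > 0 \<Longrightarrow>
      \<exists>N. \<forall>n\<ge>N. \<forall>m\<ge>N. \<forall>C\<ge>0. P n m C \<longrightarrow> P (Suc n) (Suc m) (C / 2 + \<eta>)"
    and "\<eta> > 0"
  shows "\<exists>N. \<forall>n\<ge>N. \<forall>m\<ge>N. P n m \<eta>"
proof -
  obtain N where N: "\<And>n m C. n \<ge> N \<Longrightarrow> m \<ge> N \<Longrightarrow> C \<ge> 0 \<Longrightarrow> P n m C \<Longrightarrow>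
      P (Suc n) (Suc m) (C / 2 + \<eta> / 4)"
    using step[of "\<eta> / 4"] \<open>\<eta> > 0\<close> by auto
  have iter: "P (n + k) (m + k) (C0 / 2 ^ k + \<eta> / 2)" if "n \<ge> N" "m \<ge> N" for n m k
  proof (induction k)
    case 0
    show ?case using mono[OF start] \<open>\<eta> > 0\<close> by simp
  next
    case (Suc k)
    have "P (Suc (n + k)) (Suc (m + k)) ((C0 / 2 ^ k + \<eta> / 2) / 2 + \<eta> / 4)"
      by (rule N) (use that Suc \<open>\<eta> > 0\<close> \<open>C0 \<ge> 0\<close> in auto)
    moreover have "(C0 / 2 ^ k + \<eta> / 2) / 2 + \<eta> / 4 = C0 / 2 ^ Suc k + \<eta> / 2"
      by (simp add: field_simps)
    ultimately show ?case by simp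
  qed
  obtain k where k: "C0 / (\<eta> / 2) < 2 ^ k"
    using real_arch_pow[of 2 "C0 / (\<eta> / 2)"] by auto
  then have small: "C0 / 2 ^ k + \<eta> / 2 \<le> \<eta>" using \<open>\<eta> > 0\<close> by (simp add: field_simps)
  have "P n m \<eta>" if "n \<ge> N + k" "m \<ge> N + k" for n m
    using mono[OF iter[of "n - k" "m - k" k] small] that by simp
  then show ?thesis by blast
qed

lemma continuous_bounded_interval:
  fixes h :: "real \<Rightarrow> real"
  assumes "continuous_on UNIV h"
  obtains B where "B > 0" "\<And>s. \<bar>s\<bar> \<le> M \<Longrightarrow> \<bar>h s\<bar> \<le> B"
proof -
  have "bounded (h ` {- M..M})"
    by (intro compact_imp_bounded compact_continuous_image continuous_on_subset[OF assms]) auto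
  then obtain B where B: "B > 0" "\<forall>y \<in> h ` {- M..M}. norm y \<le> B"
    using bounded_pos by metis
  show ?thesis
  proof (rule that[OF B(1)])
    fix s :: real assume "\<bar>s\<bar> \<le> M"
    then have "h s \<in> h ` {- M..M}" by (intro imageI) auto
    with B(2) show "\<bar>h s\<bar> \<le> B" by fastforce
  qed
qed

lemma uniformly_continuous_interval:
  fixes h :: "real \<Rightarrow> real"
  assumes "continuous_on UNIV h" "\<eta> > 0"
  obtains \<delta> where "\<delta> > 0"
    "\<And>a b. \<bar>a\<bar> \<le> M \<Longrightarrow> \<bar>b\<bar> \<le> M \<Longrightarrow> \<bar>a - b\<bar> < \<delta> \<Longrightarrow> \<bar>h a - h b\<bar> \<le> \<eta>"
proof -
  have "uniformly_continuous_on {- M..M} h"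
    by (intro compact_uniformly_continuous continuous_on_subset[OF assms(1)]) auto
  then obtain \<delta> where "\<delta> > 0"
    and \<delta>: "\<And>a b. a \<in> {- M..M} \<Longrightarrow> b \<in> {- M..M} \<Longrightarrow> dist b a < \<delta> \<Longrightarrow> dist (h b) (h a) < \<eta>"
    using assms(2) unfolding uniformly_continuous_on_def by metis
  show ?thesis
  proof (rule that[OF \<open>\<delta> > 0\<close>])
    fix a b :: real assume "\<bar>a\<bar> \<le> M" "\<bar>b\<bar> \<le> M" "\<bar>a - b\<bar> < \<delta>"
    then have "a \<in> {- M..M}" "b \<in> {- M..M}" "dist a b < \<delta>" by (auto simp: dist_real_def)
    from \<delta>[OF this(2,1,3)] show "\<bar>h a - h b\<bar> \<le> \<eta>" by (simp add: dist_real_def)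
  qed
qed

lemma strip_uniform_limit:
  fixes H :: "nat \<Rightarrow> real \<Rightarrow> real \<Rightarrow> real"
  assumes "\<And>n. strip_continuous T (H n)"
    and "\<And>\<eta>. \<eta> > 0 \<Longrightarrow> \<exists>N. \<forall>n\<ge>N. \<forall>m\<ge>N. \<forall>x. \<forall>t\<in>{0..T}. \<bar>H n x t - H m x t\<bar> \<le> \<eta>"
  obtains L where "strip_continuous T L"
    "\<And>\<eta>. \<eta> > 0 \<Longrightarrow> \<exists>N. \<forall>n\<ge>N. \<forall>x. \<forall>t\<in>{0..T}. \<bar>H n x t - L x t\<bar> \<le> \<eta>"
proof -
  let ?S = "UNIV \<times> {0..T} :: (real \<times> real) set"
  let ?H = "\<lambda>n z. H n (fst z) (snd z)"
  have "uniformly_Cauchy_on ?S ?H"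
    unfolding uniformly_Cauchy_on_def
  proof (intro allI impI)
    fix e :: real assume "e > 0"
    then obtain N where N: "\<forall>n\<ge>N. \<forall>m\<ge>N. \<forall>x. \<forall>t\<in>{0..T}. \<bar>H n x t - H m x t\<bar> \<le> e / 2"
      using assms(2)[of "e / 2"] by auto
    have "dist (?H m z) (?H n z) < e" if "z \<in> ?S" "m \<ge> N" "n \<ge> N" for z m n
    proof -
      have "dist (?H m z) (?H n z) \<le> e / 2" using N that by (auto simp: dist_real_def)
      then show ?thesis using \<open>e > 0\<close> by linarith
    qed
    then show "\<exists>N. \<forall>z\<in>?S. \<forall>m\<ge>N. \<forall>n\<ge>N. dist (?H m z) (?H n z) < e" by blast
  qed
  then obtain l where l: "uniform_limit ?S ?H l sequentially"
    using Cauchy_uniformly_convergent uniformly_convergent_on_def by blast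
  have "continuous_on ?S l"
    by (rule uniform_limit_theorem[OF _ l]) (use assms(1) strip_continuousD in auto)
  then have "strip_continuous T (\<lambda>x t. l (x, t))" by (intro strip_continuousI) simp
  moreover have "\<exists>N. \<forall>n\<ge>N. \<forall>x. \<forall>t\<in>{0..T}. \<bar>H n x t - l (x, t)\<bar> \<le> \<eta>" if "\<eta> > 0" for \<eta>
  proof -
    from l that have "\<forall>\<^sub>F n in sequentially. \<forall>z\<in>?S. dist (?H n z) (l z) < \<eta>"
      unfolding uniform_limit_iff by blast
    then obtain N where N: "\<And>n z. n \<ge> N \<Longrightarrow> z \<in> ?S \<Longrightarrow> dist (?H n z) (l z) < \<eta>"
      unfolding eventually_sequentially by blast
    have "\<bar>H n x t - l (x, t)\<bar> \<le> \<eta>" if "n \<ge> N" "t \<in> {0..T}" for n x t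
      using N[of n "(x, t)"] that by (auto simp: dist_real_def)
    then show ?thesis by blast
  qed
  ultimately show ?thesis by (rule that)
qed

lemma has_x_derivative_limit:
  fixes H H' :: "nat \<Rightarrow> real \<Rightarrow> real \<Rightarrow> real"
  assumes "\<And>n. has_x_derivative T (H n) (H' n)"
    and lim: "\<And>\<eta>. \<eta> > 0 \<Longrightarrow> \<exists>N. \<forall>n\<ge>N. \<forall>x. \<forall>t\<in>{0..T}. \<bar>H n x t - L x t\<bar> \<le> \<eta>"
    and lim': "\<And>\<eta>. \<eta> > 0 \<Longrightarrow> \<exists>N. \<forall>n\<ge>N. \<forall>x. \<forall>t\<in>{0..T}. \<bar>H' n x t - L' x t\<bar> \<le> \<eta>"
  shows "has_x_derivative T L L'"
  unfolding has_x_derivative_def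
proof (intro allI ballI)
  fix x t assume t: "t \<in> {0..T}"
  have conv: "(\<lambda>n. H n y t) \<longlonglongrightarrow> L y t" for y
  proof (rule LIMSEQ_I)
    fix r :: real assume "r > 0"
    then obtain N where N: "\<forall>n\<ge>N. \<forall>x. \<forall>t\<in>{0..T}. \<bar>H n x t - L x t\<bar> \<le> r / 2"
      using lim[of "r / 2"] by auto
    have "norm (H n y t - L y t) < r" if "n \<ge> N" for n
    proof -
      have "norm (H n y t - L y t) \<le> r / 2" using N that t by auto
      then show ?thesis using \<open>r > 0\<close> by linarith
    qed
    then show "\<exists>N. \<forall>n\<ge>N. norm (H n y t - L y t) < r" by blast
  qed
  have "\<exists>g. \<forall>y\<in>UNIV. (\<lambda>n. H n y t) \<longlonglongrightarrow> g y \<and> (g has_derivative (*) (L' y t)) (at y within UNIV)"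
  proof (rule has_derivative_sequence[OF convex_UNIV])
    show "((\<lambda>y. H n y t) has_derivative (*) (H' n y t)) (at y within UNIV)" for n y
      using assms(1)[of n] t unfolding has_x_derivative_def has_field_derivative_def by auto
    show "\<forall>\<^sub>F n in sequentially. \<forall>y\<in>UNIV. \<forall>h. norm (H' n y t * h - L' y t * h) \<le> e * norm h"
      if "e > 0" for e
    proof -
      obtain N where N: "\<forall>n\<ge>N. \<forall>x. \<forall>t\<in>{0..T}. \<bar>H' n x t - L' x t\<bar> \<le> e"
        using lim'[OF \<open>e > 0\<close>] by auto
      have "norm (H' n y t * h - L' y t * h) \<le> e * norm h" if "n \<ge> N" for n y h
      proof -
        have "norm (H' n y t * h - L' y t * h) = \<bar>H' n y t - L' y t\<bar> * norm h"
          by (simp add: abs_mult flip: left_diff_distrib)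
        also have "\<dots> \<le> e * norm h"
          using N that t by (intro mult_right_mono) auto
        finally show ?thesis .
      qed
      then show ?thesis unfolding eventually_sequentially by blast
    qed
  qed (use conv in auto)
  then obtain g where g: "\<And>y. (\<lambda>n. H n y t) \<longlonglongrightarrow> g y"
      "\<And>y. (g has_derivative (*) (L' y t)) (at y)"
    by auto
  have "g = (\<lambda>y. L y t)" using g(1) conv LIMSEQ_unique by blast
  with g(2)[of x] show "((\<lambda>y. L y t) has_real_derivative L' x t) (at x)"
    by (simp add: has_field_derivative_def)
qed

section \<open>Picard iteration for continuously differentiable nonlinearities\<close>

definition wave_source ::
  "(real \<Rightarrow> real) \<Rightarrow> (real \<Rightarrow> real) \<Rightarrow> (real \<Rightarrow> real \<Rightarrow> real) \<Rightarrow> (real \<Rightarrow> real \<Rightarrow> real) \<Rightarrow>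
   (real \<Rightarrow> real \<Rightarrow> real) \<Rightarrow> real \<Rightarrow> real \<Rightarrow> real" where
  "wave_source \<phi> \<psi> u0 v0 F x t = \<phi> (v0 x t + wave_t F x t) + \<psi> (u0 x t + wave F x t)"

definition picard ::
  "(real \<Rightarrow> real) \<Rightarrow> (real \<Rightarrow> real) \<Rightarrow> (real \<Rightarrow> real \<Rightarrow> real) \<Rightarrow> (real \<Rightarrow> real \<Rightarrow> real) \<Rightarrow>
   nat \<Rightarrow> real \<Rightarrow> real \<Rightarrow> real" where
  "picard \<phi> \<psi> u0 v0 n = (wave_source \<phi> \<psi> u0 v0 ^^ n) (\<lambda>x t. 0)"

text \<open>The bound \<open>M\<close>, uniform in \<open>n\<close>, is the key input: it confines
  the arguments of \<open>\<phi>\<close> and \<open>\<psi>\<close> to a compact interval, where they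
  are Lipschitz and their derivatives uniformly continuous. No smallness is asked for here; the cone
  estimates supply \<open>M\<close> later.\<close>

locale bounded_picard =
  fixes T C0 M :: real and \<phi> \<phi>' \<psi> \<psi>' :: "real \<Rightarrow> real" and u0 u0' v0 v0' :: "real \<Rightarrow> real \<Rightarrow> real"
  assumes T: "T > 0"
    and \<phi>: "\<And>s. (\<phi> has_real_derivative \<phi>' s) (at s)" "continuous_on UNIV \<phi>'"
    and \<psi>: "\<And>s. (\<psi> has_real_derivative \<psi>' s) (at s)" "continuous_on UNIV \<psi>'"
    and u0: "strip_continuous T u0" "strip_continuous T u0'" "has_x_derivative T u0 u0'"
    and v0: "strip_continuous T v0" "strip_continuous T v0'" "has_x_derivative T v0 v0'"
    and C0: "\<And>x t. t \<in> {0..T} \<Longrightarrow> \<bar>u0' x t\<bar> \<le> C0" "\<And>x t. t \<in> {0..T} \<Longrightarrow> \<bar>v0' x t\<bar> \<le> C0"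
    and M: "\<And>n x t. t \<in> {0..T} \<Longrightarrow> \<bar>u0 x t + wave (picard \<phi> \<psi> u0 v0 n) x t\<bar> \<le> M"
      "\<And>n x t. t \<in> {0..T} \<Longrightarrow> \<bar>v0 x t + wave_t (picard \<phi> \<psi> u0 v0 n) x t\<bar> \<le> M"
begin

abbreviation "F \<equiv> picard \<phi> \<psi> u0 v0"

definition "U n x t = u0 x t + wave (F n) x t"
definition "V n x t = v0 x t + wave_t (F n) x t"

text \<open>The recursion for \<open>F\<close> differentiated formally in \<open>x\<close>;
  \<open>F_has_x_derivative\<close> justifies it.\<close>

primrec Z :: "nat \<Rightarrow> real \<Rightarrow> real \<Rightarrow> real" where
  "Z 0 = (\<lambda>x t. 0)"
| "Z (Suc n) = (\<lambda>x t. \<phi>' (V n x t) * (v0' x t + wave_t (Z n) x t)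
                     + \<psi>' (U n x t) * (u0' x t + wave (Z n) x t))"

lemma F_0: "F 0 = (\<lambda>x t. 0)"
  by (simp add: picard_def)

lemma F_Suc: "F (Suc n) x t = \<phi> (V n x t) + \<psi> (U n x t)"
  by (simp add: picard_def wave_source_def U_def V_def)

lemma continuous_nonlinearity: "continuous_on UNIV \<phi>" "continuous_on UNIV \<psi>"
  using \<phi>(1) \<psi>(1) by (meson DERIV_isCont continuous_at_imp_continuous_on)+

lemma UV_continuous:
  assumes "strip_continuous T (F n)"
  shows "strip_continuous T (U n)" "strip_continuous T (V n)"
  using strip_continuousD[OF u0(1)] strip_continuousD[OF v0(1)]
    strip_continuous_wave[OF assms, THEN strip_continuousD]
    strip_continuous_wave_t[OF assms, THEN strip_continuousD]
  by (auto intro!: strip_continuousI continuous_intros simp: U_def V_def)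

lemma F_continuous: "strip_continuous T (F n)"
proof (induction n)
  case 0
  show ?case by (simp add: F_0 strip_continuous_def)
next
  case (Suc n)
  note UV = UV_continuous[OF Suc, THEN strip_continuousD]
  show ?case
    by (rule strip_continuousI)
       (auto simp: F_Suc intro!: continuous_intros UV
          continuous_on_compose2[OF continuous_nonlinearity(1)]
          continuous_on_compose2[OF continuous_nonlinearity(2)])
qed

lemma Z_continuous: "strip_continuous T (Z n)"
proof (induction n)
  case 0
  show ?case by (simp add: strip_continuous_def)
next
  case (Suc n)
  note UV = UV_continuous[OF F_continuous, THEN strip_continuousD]
  show ?case
    by (rule strip_continuousI)
       (auto intro!: continuous_intros UV u0(2)[THEN strip_continuousD] v0(2)[THEN strip_continuousD]
          strip_continuous_wave[OF Suc, THEN strip_continuousD]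
          strip_continuous_wave_t[OF Suc, THEN strip_continuousD]
          continuous_on_compose2[OF \<phi>(2)] continuous_on_compose2[OF \<psi>(2)])
qed

lemma F_has_x_derivative: "has_x_derivative T (F n) (Z n)"
proof (induction n)
  case 0
  show ?case by (simp add: F_0 has_x_derivative_def)
next
  case (Suc n)
  show ?case
    unfolding has_x_derivative_def
  proof (intro allI ballI)
    fix x t assume t: "t \<in> {0..T}"
    have U: "((\<lambda>y. U n y t) has_real_derivative u0' x t + wave (Z n) x t) (at x)"
      using u0(3) has_x_derivative_wave'[OF F_continuous Z_continuous Suc] t
      unfolding U_def has_x_derivative_def by (auto intro!: derivative_intros)
    have V: "((\<lambda>y. V n y t) has_real_derivative v0' x t + wave_t (Z n) x t) (at x)"
      using v0(3) has_x_derivative_wave_t[OF F_continuous Z_continuous Suc] t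
      unfolding V_def has_x_derivative_def by (auto intro!: derivative_intros)
    show "((\<lambda>y. F (Suc n) y t) has_real_derivative Z (Suc n) x t) (at x)"
      unfolding F_Suc using DERIV_chain2[OF \<phi>(1) V] DERIV_chain2[OF \<psi>(1) U]
      by (auto intro!: derivative_intros)
  qed
qed

lemma U_bound: "t \<in> {0..T} \<Longrightarrow> \<bar>U n x t\<bar> \<le> M" and V_bound: "t \<in> {0..T} \<Longrightarrow> \<bar>V n x t\<bar> \<le> M"
  using M by (simp_all add: U_def V_def)

text \<open>\<open>G\<close> and \<open>G'\<close> are the uniform limits of \<open>F n\<close> and
  \<open>Z n\<close>. Convergence of \<open>F n\<close> has to come first, because the coefficients
  \<open>\<phi>' (V n x t)\<close> and \<open>\<psi>' (U n x t)\<close> in \<open>Z\<close> must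
  already be close when two of the \<open>Z n\<close> are compared.\<close>

lemma fixed_point:
  obtains G G' where "strip_continuous T G" "strip_continuous T G'" "has_x_derivative T G G'"
    "\<And>x t. t \<in> {0..T} \<Longrightarrow> G x t = wave_source \<phi> \<psi> u0 v0 G x t"
proof -
  obtain \<Lambda> where \<Lambda>: "\<Lambda> > 0" "\<And>s. \<bar>s\<bar> \<le> M \<Longrightarrow> \<bar>\<phi>' s\<bar> \<le> \<Lambda>" "\<And>s. \<bar>s\<bar> \<le> M \<Longrightarrow> \<bar>\<psi>' s\<bar> \<le> \<Lambda>"
  proof -
    obtain B1 where "B1 > 0" "\<And>s. \<bar>s\<bar> \<le> M \<Longrightarrow> \<bar>\<phi>' s\<bar> \<le> B1"
      using continuous_bounded_interval[OF \<phi>(2)] by blast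
    moreover obtain B2 where "B2 > 0" "\<And>s. \<bar>s\<bar> \<le> M \<Longrightarrow> \<bar>\<psi>' s\<bar> \<le> B2"
      using continuous_bounded_interval[OF \<psi>(2)] by blast
    ultimately show ?thesis using that[of "max B1 B2"] by (meson less_max_iff_disj max.coboundedI1 max.coboundedI2)
  qed
  have lipschitz: "\<bar>h a - h b\<bar> \<le> \<Lambda> * \<bar>a - b\<bar>"
    if "\<bar>a\<bar> \<le> M" "\<bar>b\<bar> \<le> M" "\<And>s. (h has_real_derivative h' s) (at s)" "\<And>s. \<bar>s\<bar> \<le> M \<Longrightarrow> \<bar>h' s\<bar> \<le> \<Lambda>"
    for h h' a b
  proof -
    have "norm (h a - h b) \<le> \<Lambda> * norm (a - b)"
    proof (rule field_differentiable_bound[of "{- M..M}"])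
      show "(h has_field_derivative h' s) (at s within {- M..M})" for s
        using that(3) by (rule has_field_derivative_at_within)
      show "norm (h' s) \<le> \<Lambda>" if "s \<in> {- M..M}" for s
        using \<open>\<And>s. \<bar>s\<bar> \<le> M \<Longrightarrow> \<bar>h' s\<bar> \<le> \<Lambda>\<close> that by auto
    qed (use that(1,2) in auto)
    then show ?thesis by simp
  qed
  \<comment> \<open>With this weight each of the two nonlinear terms contracts by
    \<open>\<Lambda> / \<mu> \<le> 1 / 4\<close>, hence their sum by one half.\<close>
  define \<mu> where "\<mu> = max 1 (4 * \<Lambda>)"
  have \<mu>: "\<mu> \<ge> 1" "\<mu> > 0" "\<Lambda> / \<mu> \<le> 1 / 4" by (auto simp: \<mu>_def field_simps)
  have exp1: "exp (\<mu> * t) \<ge> 1" if "t \<in> {0..T}" for t using that \<mu> by simp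
  have expT: "exp (\<mu> * t) \<le> exp (\<mu> * T)" if "t \<in> {0..T}" for t using that \<mu> by simp
  have quarter: "\<Lambda> * (C / \<mu> * e) \<le> C / 4 * e" if "C \<ge> 0" "e \<ge> 0" for C e
  proof -
    have "\<Lambda> * (C / \<mu> * e) = (\<Lambda> / \<mu>) * (C * e)" by simp
    also have "\<dots> \<le> 1 / 4 * (C * e)" using \<mu> that by (intro mult_right_mono) auto
    finally show ?thesis by simp
  qed
  have diff_wave_t: "\<bar>wave_t H x t - wave_t K x t\<bar> \<le> C / \<mu> * exp (\<mu> * t)"
    and diff_wave: "\<bar>wave H x t - wave K x t\<bar> \<le> C / \<mu> * exp (\<mu> * t)"
    if "strip_continuous T H" "strip_continuous T K" "C \<ge> 0" "t \<in> {0..T}"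
      "\<And>x t. t \<in> {0..T} \<Longrightarrow> \<bar>H x t - K x t\<bar> \<le> C * exp (\<mu> * t)" for H K C x t
  proof -
    have c: "strip_continuous T (\<lambda>x t. H x t - K x t)"
      using that(1,2)[THEN strip_continuousD] by (auto intro!: strip_continuousI continuous_intros)
    show "\<bar>wave_t H x t - wave_t K x t\<bar> \<le> C / \<mu> * exp (\<mu> * t)"
      using wave_t_exp_bound[OF c that(4) \<mu>(2) that(3,5)] wave_t_diff[OF that(1,2,4)] by simp
    show "\<bar>wave H x t - wave K x t\<bar> \<le> C / \<mu> * exp (\<mu> * t)"
      using wave_exp_bound[OF c that(4) \<mu>(1) that(3,5)] wave_diff[OF that(1,2,4)] by simp
  qed
  define close where "close H n m C \<longleftrightarrow> (\<forall>x. \<forall>t\<in>{0..T}. \<bar>H n x t - H m x t\<bar> \<le> C * exp (\<mu> * t))"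
    for H :: "nat \<Rightarrow> real \<Rightarrow> real \<Rightarrow> real" and n m C
  have closeD: "\<bar>H n x t - H m x t\<bar> \<le> C * exp (\<mu> * t)" if "close H n m C" "t \<in> {0..T}" for H n m C x t
    using that by (auto simp: close_def)
  have close_mono: "close H n m D" if "close H n m C" "C \<le> D" for H n m C D
    using that unfolding close_def by (meson exp_ge_zero mult_right_mono order_trans)
  have close_bounded: "close H n m (2 * D)"
    if "\<And>n x t. t \<in> {0..T} \<Longrightarrow> \<bar>H n x t\<bar> \<le> D * exp (\<mu> * t)" for H n m D
    unfolding close_def
  proof (intro allI ballI)
    fix x t assume "t \<in> {0..T}"
    then have "\<bar>H n x t\<bar> \<le> D * exp (\<mu> * t)" "\<bar>H m x t\<bar> \<le> D * exp (\<mu> * t)" by (auto intro: that)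
    then show "\<bar>H n x t - H m x t\<bar> \<le> 2 * D * exp (\<mu> * t)" by linarith
  qed
  have Cauchy: "\<exists>N. \<forall>n\<ge>N. \<forall>m\<ge>N. \<forall>x. \<forall>t\<in>{0..T}. \<bar>H n x t - H m x t\<bar> \<le> \<eta>"
    if H: "\<And>\<eta>. \<eta> > 0 \<Longrightarrow> \<exists>N. \<forall>n\<ge>N. \<forall>m\<ge>N. close H n m \<eta>" and "\<eta> > 0" for H \<eta>
  proof -
    obtain N where N: "\<And>n m. n \<ge> N \<Longrightarrow> m \<ge> N \<Longrightarrow> close H n m (\<eta> / exp (\<mu> * T))"
      using H[of "\<eta> / exp (\<mu> * T)"] \<open>\<eta> > 0\<close> by auto
    have "\<bar>H n x t - H m x t\<bar> \<le> \<eta>" if "n \<ge> N" "m \<ge> N" "t \<in> {0..T}" for n m x t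
    proof -
      have "\<bar>H n x t - H m x t\<bar> \<le> \<eta> / exp (\<mu> * T) * exp (\<mu> * t)"
        using closeD[OF N] that by blast
      also have "\<dots> \<le> \<eta> / exp (\<mu> * T) * exp (\<mu> * T)"
        using expT[OF that(3)] \<open>\<eta> > 0\<close> by (intro mult_left_mono) auto
      finally show ?thesis by simp
    qed
    then show ?thesis by blast
  qed

  have F_step: "close F (Suc n) (Suc m) (C / 2)" if "close F n m C" "C \<ge> 0" for n m C
    unfolding close_def
  proof (intro allI ballI)
    fix x t assume t: "t \<in> {0..T}"
    have "\<bar>\<phi> (V n x t) - \<phi> (V m x t)\<bar> \<le> \<Lambda> * \<bar>V n x t - V m x t\<bar>"
      by (rule lipschitz[OF _ _ \<phi>(1) \<Lambda>(2)]) (auto intro!: V_bound t)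
    also have "\<dots> \<le> \<Lambda> * (C / \<mu> * exp (\<mu> * t))"
      using diff_wave_t[OF F_continuous F_continuous that(2) t closeD[OF that(1)], of x] \<Lambda>(1)
      by (intro mult_left_mono) (auto simp: V_def)
    also have "\<dots> \<le> C / 4 * exp (\<mu> * t)" using that by (intro quarter) auto
    finally have 1: "\<bar>\<phi> (V n x t) - \<phi> (V m x t)\<bar> \<le> C / 4 * exp (\<mu> * t)" .
    have "\<bar>\<psi> (U n x t) - \<psi> (U m x t)\<bar> \<le> \<Lambda> * \<bar>U n x t - U m x t\<bar>"
      by (rule lipschitz[OF _ _ \<psi>(1) \<Lambda>(3)]) (auto intro!: U_bound t)
    also have "\<dots> \<le> \<Lambda> * (C / \<mu> * exp (\<mu> * t))"
      using diff_wave[OF F_continuous F_continuous that(2) t closeD[OF that(1)], of x] \<Lambda>(1)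
      by (intro mult_left_mono) (auto simp: U_def)
    also have "\<dots> \<le> C / 4 * exp (\<mu> * t)" using that by (intro quarter) auto
    finally have 2: "\<bar>\<psi> (U n x t) - \<psi> (U m x t)\<bar> \<le> C / 4 * exp (\<mu> * t)" .
    have "\<bar>F (Suc n) x t - F (Suc m) x t\<bar> \<le>
        \<bar>\<phi> (V n x t) - \<phi> (V m x t)\<bar> + \<bar>\<psi> (U n x t) - \<psi> (U m x t)\<bar>"
      unfolding F_Suc by linarith
    also have "\<dots> \<le> C / 2 * exp (\<mu> * t)" using 1 2 by simp
    finally show "\<bar>F (Suc n) x t - F (Suc m) x t\<bar> \<le> C / 2 * exp (\<mu> * t)" .
  qed
  \<comment> \<open>After the zeroth, every iterate is the nonlinearity evaluated at arguments of
    size at most \<open>M\<close>.\<close>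
  obtain B where B: "B > 0" "\<And>n x t. t \<in> {0..T} \<Longrightarrow> \<bar>F n x t\<bar> \<le> B * exp (\<mu> * t)"
  proof -
    obtain B1 where B1: "B1 > 0" "\<And>s. \<bar>s\<bar> \<le> M \<Longrightarrow> \<bar>\<phi> s\<bar> \<le> B1"
      using continuous_bounded_interval[OF continuous_nonlinearity(1)] by blast
    obtain B2 where B2: "B2 > 0" "\<And>s. \<bar>s\<bar> \<le> M \<Longrightarrow> \<bar>\<psi> s\<bar> \<le> B2"
      using continuous_bounded_interval[OF continuous_nonlinearity(2)] by blast
    have "\<bar>F n x t\<bar> \<le> (B1 + B2) * exp (\<mu> * t)" if t: "t \<in> {0..T}" for n x t
    proof -
      have "\<bar>F n x t\<bar> \<le> B1 + B2"
      proof (cases n)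
        case 0
        then show ?thesis using B1(1) B2(1) by (simp add: F_0)
      next
        case (Suc k)
        show ?thesis
          using B1(2)[OF V_bound[OF t, of k x]] B2(2)[OF U_bound[OF t, of k x]]
          unfolding Suc F_Suc by linarith
      qed
      also have "\<dots> \<le> (B1 + B2) * exp (\<mu> * t)"
        using B1(1) B2(1) exp1[OF t] by (simp add: mult_le_cancel_left1)
      finally show ?thesis .
    qed
    with B1(1) B2(1) show ?thesis by (intro that[of "B1 + B2"]) auto
  qed
  have F_close: "\<exists>N. \<forall>n\<ge>N. \<forall>m\<ge>N. close F n m \<eta>" if "\<eta> > 0" for \<eta>
  proof (rule contraction_with_vanishing_error[where P = "close F" and ?C0.0 = "2 * B"])
    show "\<exists>N. \<forall>n\<ge>N. \<forall>m\<ge>N. \<forall>C\<ge>0. close F n m C \<longrightarrow> close F (Suc n) (Suc m) (C / 2 + \<eta>)"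
      if "\<eta> > 0" for \<eta>
      using F_step close_mono that by (metis add_increasing2 less_eq_real_def order_refl)
  qed (use close_mono close_bounded[OF B(2)] B(1) that in auto)
  obtain G where G: "strip_continuous T G"
    "\<And>\<eta>. \<eta> > 0 \<Longrightarrow> \<exists>N. \<forall>n\<ge>N. \<forall>x. \<forall>t\<in>{0..T}. \<bar>F n x t - G x t\<bar> \<le> \<eta>"
    using strip_uniform_limit[OF F_continuous Cauchy[OF F_close]] by blast

  \<comment> \<open>In each of the two summands of \<open>Z (Suc n)\<close> the free data cost at
    most \<open>\<Lambda> * \<bar>C0\<bar> = D / 4\<close> and the previous iterate another
    \<open>D / 4\<close>, so the bound \<open>D\<close> reproduces itself.\<close>
  define D where "D = 4 * \<Lambda> * \<bar>C0\<bar>"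
  have D: "D \<ge> 0" using \<Lambda>(1) by (simp add: D_def)
  have Z_bound: "\<bar>Z n x t\<bar> \<le> D * exp (\<mu> * t)" if "t \<in> {0..T}" for n x t
    using that
  proof (induction n arbitrary: x t)
    case 0
    then show ?case using D by simp
  next
    case (Suc n)
    note t = \<open>t \<in> {0..T}\<close>
    have part: "\<bar>a * (b + w)\<bar> \<le> D / 2 * exp (\<mu> * t)"
      if "\<bar>a\<bar> \<le> \<Lambda>" "\<bar>b\<bar> \<le> C0" "\<bar>w\<bar> \<le> D / \<mu> * exp (\<mu> * t)" for a b w
    proof -
      have "\<bar>a * (b + w)\<bar> \<le> \<Lambda> * (\<bar>C0\<bar> + D / \<mu> * exp (\<mu> * t))"
        unfolding abs_mult using that by (intro mult_mono) auto
      also have "\<dots> \<le> \<Lambda> * \<bar>C0\<bar> + D / 4 * exp (\<mu> * t)"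
        using quarter[OF D, of "exp (\<mu> * t)"] by (simp add: distrib_left)
      also have "\<Lambda> * \<bar>C0\<bar> \<le> D / 4 * exp (\<mu> * t)"
        using mult_left_mono[OF exp1[OF t], of "\<Lambda> * \<bar>C0\<bar>"] \<Lambda>(1) by (simp add: D_def)
      finally show ?thesis by simp
    qed
    have "\<bar>\<phi>' (V n x t) * (v0' x t + wave_t (Z n) x t)\<bar> \<le> D / 2 * exp (\<mu> * t)"
      by (intro part \<Lambda> V_bound C0 t wave_t_exp_bound[OF Z_continuous t \<mu>(2) D] Suc.IH)
    moreover have "\<bar>\<psi>' (U n x t) * (u0' x t + wave (Z n) x t)\<bar> \<le> D / 2 * exp (\<mu> * t)"
      by (intro part \<Lambda> U_bound C0 t wave_exp_bound[OF Z_continuous t \<mu>(1) D] Suc.IH)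
    ultimately show ?case by simp
  qed
  define E where "E = \<bar>C0\<bar> + D * exp (\<mu> * T)"
  have E: "E \<ge> 0" using D by (simp add: E_def)
  have E_bound: "\<bar>v0' x t + wave_t (Z n) x t\<bar> \<le> E" "\<bar>u0' x t + wave (Z n) x t\<bar> \<le> E"
    if t: "t \<in> {0..T}" for n x t
  proof -
    have "D / \<mu> * exp (\<mu> * t) \<le> D * exp (\<mu> * T)"
      using D \<mu> expT[OF t] by (intro mult_mono) (auto simp: divide_le_eq mult_le_cancel_left1)
    moreover have "\<bar>wave_t (Z n) x t\<bar> \<le> D / \<mu> * exp (\<mu> * t)"
      by (intro wave_t_exp_bound[OF Z_continuous t \<mu>(2) D] Z_bound)
    moreover have "\<bar>wave (Z n) x t\<bar> \<le> D / \<mu> * exp (\<mu> * t)"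
      by (intro wave_exp_bound[OF Z_continuous t \<mu>(1) D] Z_bound)
    ultimately show "\<bar>v0' x t + wave_t (Z n) x t\<bar> \<le> E" "\<bar>u0' x t + wave (Z n) x t\<bar> \<le> E"
      using C0[OF t, of x] unfolding E_def by linarith+
  qed
  have Z_close: "\<exists>N. \<forall>n\<ge>N. \<forall>m\<ge>N. close Z n m \<eta>" if "\<eta> > 0" for \<eta>
  proof (rule contraction_with_vanishing_error[where P = "close Z" and ?C0.0 = "2 * D"])
    fix \<eta> :: real assume "\<eta> > 0"
    \<comment> \<open>Two coefficient errors, each multiplied by a factor of size at most
      \<open>E\<close>, must fit into \<open>\<eta>\<close>; the summand 1 covers
      \<open>E = 0\<close>.\<close>
    define \<eta>' where "\<eta>' = \<eta> / (2 * E + 1)"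
    have \<eta>': "\<eta>' > 0" "2 * (\<eta>' * E) \<le> \<eta>"
      using \<open>\<eta> > 0\<close> E by (auto simp: \<eta>'_def field_simps add_pos_nonneg)
    obtain \<delta>1 where \<delta>1: "\<delta>1 > 0"
      "\<And>a b. \<bar>a\<bar> \<le> M \<Longrightarrow> \<bar>b\<bar> \<le> M \<Longrightarrow> \<bar>a - b\<bar> < \<delta>1 \<Longrightarrow> \<bar>\<phi>' a - \<phi>' b\<bar> \<le> \<eta>'"
      using uniformly_continuous_interval[OF \<phi>(2) \<eta>'(1)] by blast
    obtain \<delta>2 where \<delta>2: "\<delta>2 > 0"
      "\<And>a b. \<bar>a\<bar> \<le> M \<Longrightarrow> \<bar>b\<bar> \<le> M \<Longrightarrow> \<bar>a - b\<bar> < \<delta>2 \<Longrightarrow> \<bar>\<psi>' a - \<psi>' b\<bar> \<le> \<eta>'"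
      using uniformly_continuous_interval[OF \<psi>(2) \<eta>'(1)] by blast
    define \<delta> where "\<delta> = min \<delta>1 \<delta>2 / (2 * exp (\<mu> * T))"
    have \<delta>: "\<delta> > 0" using \<delta>1(1) \<delta>2(1) by (simp add: \<delta>_def)
    have small: "\<delta> / \<mu> * exp (\<mu> * t) < min \<delta>1 \<delta>2" if "t \<in> {0..T}" for t
    proof -
      have "\<delta> / \<mu> * exp (\<mu> * t) \<le> \<delta> * exp (\<mu> * T)"
        using \<delta> \<mu> expT[OF that] by (intro mult_mono) (auto simp: divide_le_eq mult_le_cancel_left1)
      also have "\<dots> = min \<delta>1 \<delta>2 / 2" by (simp add: \<delta>_def)
      also have "\<dots> < min \<delta>1 \<delta>2" using \<delta>1(1) \<delta>2(1) by linarith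
      finally show ?thesis .
    qed
    obtain N where N: "\<And>n m. n \<ge> N \<Longrightarrow> m \<ge> N \<Longrightarrow> close F n m \<delta>"
      using F_close[OF \<delta>] by auto
    have "close Z (Suc n) (Suc m) (C / 2 + \<eta>)"
      if nm: "n \<ge> N" "m \<ge> N" and C: "C \<ge> 0" and Z: "close Z n m C" for n m C
      unfolding close_def
    proof (intro allI ballI)
      fix x t assume t: "t \<in> {0..T}"
      \<comment> \<open>The difference of the second factors contracts, but the difference of the
        coefficients is merely small, not proportional to \<open>C\<close>: this is the vanishing
        error.\<close>
      have split: "\<bar>a * b - c * d\<bar> \<le> C / 4 * exp (\<mu> * t) + \<eta>' * E"
        if "\<bar>a\<bar> \<le> \<Lambda>" "\<bar>b - d\<bar> \<le> C / \<mu> * exp (\<mu> * t)" "\<bar>a - c\<bar> \<le> \<eta>'" "\<bar>d\<bar> \<le> E" for a b c d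
      proof -
        have "a * b - c * d = a * (b - d) + (a - c) * d" by (simp add: algebra_simps)
        also have "\<bar>\<dots>\<bar> \<le> \<bar>a\<bar> * \<bar>b - d\<bar> + \<bar>a - c\<bar> * \<bar>d\<bar>"
          by (metis abs_mult abs_triangle_ineq)
        also have "\<dots> \<le> \<Lambda> * (C / \<mu> * exp (\<mu> * t)) + \<eta>' * E"
          using that \<Lambda>(1) \<eta>'(1) by (intro add_mono mult_mono) auto
        also have "\<dots> \<le> C / 4 * exp (\<mu> * t) + \<eta>' * E"
          using quarter[OF C, of "exp (\<mu> * t)"] by simp
        finally show ?thesis .
      qed
      have "\<bar>\<phi>' (V n x t) * (v0' x t + wave_t (Z n) x t) - \<phi>' (V m x t) * (v0' x t + wave_t (Z m) x t)\<bar>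
          \<le> C / 4 * exp (\<mu> * t) + \<eta>' * E"
      proof (rule split)
        show "\<bar>v0' x t + wave_t (Z n) x t - (v0' x t + wave_t (Z m) x t)\<bar> \<le> C / \<mu> * exp (\<mu> * t)"
          using diff_wave_t[OF Z_continuous Z_continuous C t closeD[OF Z]] by simp
        have "\<bar>V n x t - V m x t\<bar> \<le> \<delta> / \<mu> * exp (\<mu> * t)"
          using diff_wave_t[OF F_continuous F_continuous _ t closeD[OF N[OF nm]], of x] \<delta>
          by (simp add: V_def)
        then show "\<bar>\<phi>' (V n x t) - \<phi>' (V m x t)\<bar> \<le> \<eta>'"
          using small[OF t] by (intro \<delta>1(2) V_bound t) auto
      qed (intro \<Lambda> V_bound E_bound t)+
      moreover have "\<bar>\<psi>' (U n x t) * (u0' x t + wave (Z n) x t) - \<psi>' (U m x t) * (u0' x t + wave (Z m) x t)\<bar>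
          \<le> C / 4 * exp (\<mu> * t) + \<eta>' * E"
      proof (rule split)
        show "\<bar>u0' x t + wave (Z n) x t - (u0' x t + wave (Z m) x t)\<bar> \<le> C / \<mu> * exp (\<mu> * t)"
          using diff_wave[OF Z_continuous Z_continuous C t closeD[OF Z]] by simp
        have "\<bar>U n x t - U m x t\<bar> \<le> \<delta> / \<mu> * exp (\<mu> * t)"
          using diff_wave[OF F_continuous F_continuous _ t closeD[OF N[OF nm]], of x] \<delta>
          by (simp add: U_def)
        then show "\<bar>\<psi>' (U n x t) - \<psi>' (U m x t)\<bar> \<le> \<eta>'"
          using small[OF t] by (intro \<delta>2(2) U_bound t) auto
      qed (intro \<Lambda> U_bound E_bound t)+
      ultimately have "\<bar>Z (Suc n) x t - Z (Suc m) x t\<bar> \<le> C / 2 * exp (\<mu> * t) + 2 * (\<eta>' * E)"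
        by simp
      also have "\<dots> \<le> C / 2 * exp (\<mu> * t) + \<eta> * exp (\<mu> * t)"
        using \<eta>'(2) exp1[OF t] \<open>\<eta> > 0\<close> by (intro add_left_mono) (smt (verit) mult_le_cancel_left1)
      finally show "\<bar>Z (Suc n) x t - Z (Suc m) x t\<bar> \<le> (C / 2 + \<eta>) * exp (\<mu> * t)"
        by (simp add: distrib_right)
    qed
    then show "\<exists>N. \<forall>n\<ge>N. \<forall>m\<ge>N. \<forall>C\<ge>0. close Z n m C \<longrightarrow> close Z (Suc n) (Suc m) (C / 2 + \<eta>)"
      by blast
  qed (use close_mono close_bounded[OF Z_bound] D that in auto)
  obtain G' where G': "strip_continuous T G'"
    "\<And>\<eta>. \<eta> > 0 \<Longrightarrow> \<exists>N. \<forall>n\<ge>N. \<forall>x. \<forall>t\<in>{0..T}. \<bar>Z n x t - G' x t\<bar> \<le> \<eta>"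
    using strip_uniform_limit[OF Z_continuous Cauchy[OF Z_close]] by blast
  have deriv: "has_x_derivative T G G'"
    by (rule has_x_derivative_limit[OF F_has_x_derivative G(2) G'(2)])

  have eq: "G x t = wave_source \<phi> \<psi> u0 v0 G x t" if t: "t \<in> {0..T}" for x t
  proof -
    \<comment> \<open>Whatever is controlled by the uniform distance of \<open>F n\<close> to
      \<open>G\<close> converges. Applied to \<open>wave_t\<close>, \<open>wave\<close> and
      \<open>F\<close> itself, this carries the recursion over to the limit.\<close>
    have lim: "(\<lambda>n. a n) \<longlonglongrightarrow> b"
      if a: "\<And>\<eta> n. \<eta> > 0 \<Longrightarrow> (\<And>x t. t \<in> {0..T} \<Longrightarrow> \<bar>F n x t - G x t\<bar> \<le> \<eta>) \<Longrightarrow> \<bar>a n - b\<bar> \<le> \<eta> * exp (\<mu> * T)"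
      for a :: "nat \<Rightarrow> real" and b
    proof (rule LIMSEQ_I)
      fix r :: real assume "r > 0"
      define \<eta> where "\<eta> = r / (2 * exp (\<mu> * T))"
      have \<eta>: "\<eta> > 0" "\<eta> * exp (\<mu> * T) < r" using \<open>r > 0\<close> by (auto simp: \<eta>_def)
      obtain N where N: "\<forall>n\<ge>N. \<forall>x. \<forall>t\<in>{0..T}. \<bar>F n x t - G x t\<bar> \<le> \<eta>"
        using G(2)[OF \<eta>(1)] by blast
      have "norm (a n - b) < r" if "n \<ge> N" for n
      proof -
        have "\<bar>a n - b\<bar> \<le> \<eta> * exp (\<mu> * T)" using N that by (intro a \<eta>(1)) auto
        with \<eta>(2) show ?thesis by simp
      qed
      then show "\<exists>N. \<forall>n\<ge>N. norm (a n - b) < r" by blast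
    qed
    have close_exp: "\<bar>F n x t - G x t\<bar> \<le> \<eta> * exp (\<mu> * t)"
      if "\<eta> > 0" "\<And>x t. t \<in> {0..T} \<Longrightarrow> \<bar>F n x t - G x t\<bar> \<le> \<eta>" "t \<in> {0..T}" for \<eta> n x t
      using that(2)[OF that(3), of x] exp1[OF that(3)] that(1) by (smt (verit) mult_le_cancel_left1)
    have exp_le: "\<eta> / \<mu> * exp (\<mu> * t) \<le> \<eta> * exp (\<mu> * T)" if "\<eta> > 0" for \<eta>
      using that \<mu> expT[OF t] by (intro mult_mono) (auto simp: divide_le_eq mult_le_cancel_left1)
    have "(\<lambda>n. wave_t (F n) x t) \<longlonglongrightarrow> wave_t G x t"
    proof (rule lim)
      fix \<eta> n assume *: "\<eta> > 0" "\<And>x t. t \<in> {0..T} \<Longrightarrow> \<bar>F n x t - G x t\<bar> \<le> \<eta>"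
      have "\<bar>wave_t (F n) x t - wave_t G x t\<bar> \<le> \<eta> / \<mu> * exp (\<mu> * t)"
        using * by (intro diff_wave_t F_continuous G(1) t close_exp) auto
      with exp_le[OF *(1)] show "\<bar>wave_t (F n) x t - wave_t G x t\<bar> \<le> \<eta> * exp (\<mu> * T)" by linarith
    qed
    then have "(\<lambda>n. \<phi> (V n x t)) \<longlonglongrightarrow> \<phi> (v0 x t + wave_t G x t)"
      unfolding V_def
      by (intro isCont_tendsto_compose[OF DERIV_isCont[OF \<phi>(1)]] tendsto_intros)
    moreover have "(\<lambda>n. wave (F n) x t) \<longlonglongrightarrow> wave G x t"
    proof (rule lim)
      fix \<eta> n assume *: "\<eta> > 0" "\<And>x t. t \<in> {0..T} \<Longrightarrow> \<bar>F n x t - G x t\<bar> \<le> \<eta>"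
      have "\<bar>wave (F n) x t - wave G x t\<bar> \<le> \<eta> / \<mu> * exp (\<mu> * t)"
        using * by (intro diff_wave F_continuous G(1) t close_exp) auto
      with exp_le[OF *(1)] show "\<bar>wave (F n) x t - wave G x t\<bar> \<le> \<eta> * exp (\<mu> * T)" by linarith
    qed
    then have "(\<lambda>n. \<psi> (U n x t)) \<longlonglongrightarrow> \<psi> (u0 x t + wave G x t)"
      unfolding U_def
      by (intro isCont_tendsto_compose[OF DERIV_isCont[OF \<psi>(1)]] tendsto_intros)
    ultimately have "(\<lambda>n. F (Suc n) x t) \<longlonglongrightarrow> wave_source \<phi> \<psi> u0 v0 G x t"
      unfolding F_Suc wave_source_def by (rule tendsto_add)
    moreover have "(\<lambda>n. F n x t) \<longlonglongrightarrow> G x t"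
    proof (rule lim)
      fix \<eta> n assume *: "\<eta> > 0" "\<And>x t. t \<in> {0..T} \<Longrightarrow> \<bar>F n x t - G x t\<bar> \<le> \<eta>"
      have "\<bar>F n x t - G x t\<bar> \<le> \<eta> * exp (\<mu> * t)" by (rule close_exp[OF * t])
      also have "\<dots> \<le> \<eta> * exp (\<mu> * T)" using expT[OF t] *(1) by (intro mult_left_mono) auto
      finally show "\<bar>F n x t - G x t\<bar> \<le> \<eta> * exp (\<mu> * T)" .
    qed
    then have "(\<lambda>n. F (Suc n) x t) \<longlonglongrightarrow> G x t" by (rule LIMSEQ_Suc)
    ultimately show ?thesis using LIMSEQ_unique by blast
  qed
  show ?thesis by (rule that[OF G(1) G'(1) deriv eq])
qed

end

subsection \<open>Classical solutions\<close>

lemma strip_continuous_cong: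
  assumes "\<And>x t. t \<in> {0..T} \<Longrightarrow> u x t = w x t"
  shows "strip_continuous T u \<longleftrightarrow> strip_continuous T w"
  unfolding strip_continuous_def by (rule continuous_on_cong) (auto simp: assms)

lemma dt_cong:
  assumes "\<And>x t. t \<in> {0..T} \<Longrightarrow> u x t = w x t" "t \<in> {0..T}"
  shows "dt T u x t = dt T w x t"
proof -
  have "((\<lambda>s. u x s) has_vector_derivative D) (at t within {0..T}) \<longleftrightarrow>
        ((\<lambda>s. w x s) has_vector_derivative D) (at t within {0..T})" for D
    using assms by (metis has_vector_derivative_transform)
  then show ?thesis unfolding dt_def vector_derivative_def by simp
qed

text \<open>\<open>dx\<close> and \<open>dt\<close> match explicit derivative formulas only for
  times in \<open>[0, T]\<close>, so replacing one by the other requires that values outside the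
  strip do not affect the regularity class.\<close>

lemma C_k_strip_cong:
  assumes "\<And>x t. t \<in> {0..T} \<Longrightarrow> u x t = w x t" "C_k_strip k T u"
  shows "C_k_strip k T w"
  using assms
proof (induction k arbitrary: u w)
  case 0
  then show ?case using strip_continuous_cong[of T u w] by (simp add: strip_continuous_def)
next
  case (Suc k)
  have eq: "(\<lambda>y. w y t) = (\<lambda>y. u y t)" if "t \<in> {0..T}" for t
    using Suc.prems(1)[OF that] by auto
  have "C_k_strip k T (dx w)"
  proof (rule Suc.IH)
    show "dx u x t = dx w x t" if "t \<in> {0..T}" for x t
      by (simp add: dx_def eq[OF that])
  qed (use Suc.prems in simp)
  moreover have "C_k_strip k T (dt T w)"
    by (rule Suc.IH[of "dt T u"]) (use Suc.prems dt_cong[of T u w] in auto)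
  moreover have "(\<lambda>s. w x s) differentiable (at t within {0..T})" if "t \<in> {0..T}" for x t
    by (rule differentiable_transform_within[OF _ zero_less_one that, of "\<lambda>s. u x s"])
       (use Suc.prems that in auto)
  moreover have "continuous_on (UNIV \<times> {0..T}) (\<lambda>(x, t). w x t)"
    using strip_continuous_cong[of T u w] Suc.prems by (simp add: strip_continuous_def)
  moreover have "(\<lambda>y. w y t) differentiable (at x)" if "t \<in> {0..T}" for x t
    using Suc.prems(2) that eq[OF that] by auto
  ultimately show ?case by simp
qed

lemma dx_eq:
  assumes "has_x_derivative T u ux" "t \<in> {0..T}"
  shows "dx u x t = ux x t"
  using assms unfolding has_x_derivative_def dx_def by (intro DERIV_imp_deriv) auto

lemma dt_eq:
  assumes "T > 0" "has_t_derivative T u ut" "t \<in> {0..T}"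
  shows "dt T u x t = ut x t"
  using assms unfolding has_t_derivative_def dt_def
  by (intro vector_derivative_within_closed_interval)
     (auto simp flip: has_real_derivative_iff_has_vector_derivative)

lemma C_k_strip_SucI:
  assumes "T > 0" "strip_continuous T u" "has_x_derivative T u ux" "has_t_derivative T u ut"
    and "C_k_strip k T ux" "C_k_strip k T ut"
  shows "C_k_strip (Suc k) T u"
proof -
  have "C_k_strip k T (dx u)"
    by (rule C_k_strip_cong[OF _ assms(5)]) (simp add: dx_eq[OF assms(3)])
  moreover have "C_k_strip k T (dt T u)"
    by (rule C_k_strip_cong[OF _ assms(6)]) (simp add: dt_eq[OF assms(1,4)])
  moreover have "(\<lambda>y. u y t) differentiable (at x)" if "t \<in> {0..T}" for x t
    using assms(3) that unfolding has_x_derivative_def real_differentiable_def by blast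
  moreover have "(\<lambda>s. u x s) differentiable (at t within {0..T})" if "t \<in> {0..T}" for x t
    using assms(4) that unfolding has_t_derivative_def real_differentiable_def by blast
  ultimately show ?thesis
    using assms(2) by (simp add: strip_continuous_def)
qed

lemma has_x_derivative_add:
  assumes "has_x_derivative T F F'" "has_x_derivative T H H'"
  shows "has_x_derivative T (\<lambda>x t. F x t + H x t) (\<lambda>x t. F' x t + H' x t)"
  using assms unfolding has_x_derivative_def by (auto intro!: derivative_intros)

lemma has_t_derivative_add:
  assumes "has_t_derivative T F F'" "has_t_derivative T H H'"
  shows "has_t_derivative T (\<lambda>x t. F x t + H x t) (\<lambda>x t. F' x t + H' x t)"
  using assms unfolding has_t_derivative_def by (auto intro!: derivative_intros)

lemma strip_continuous_add:
  assumes "strip_continuous T F" "strip_continuous T H"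
  shows "strip_continuous T (\<lambda>x t. F x t + H x t)"
  using assms[THEN strip_continuousD] by (intro strip_continuousI continuous_intros)

lemma travelling_waves:
  assumes "\<And>x. (a has_real_derivative a' x) (at x)" "\<And>x. (b has_real_derivative b' x) (at x)"
  shows "has_x_derivative T (\<lambda>x t. a (x + t) + b (x - t)) (\<lambda>x t. a' (x + t) + b' (x - t))"
    and "has_t_derivative T (\<lambda>x t. a (x + t) + b (x - t)) (\<lambda>x t. a' (x + t) - b' (x - t))"
    and "has_x_derivative T (\<lambda>x t. a (x + t) - b (x - t)) (\<lambda>x t. a' (x + t) - b' (x - t))"
    and "has_t_derivative T (\<lambda>x t. a (x + t) - b (x - t)) (\<lambda>x t. a' (x + t) + b' (x - t))"
  unfolding has_x_derivative_def has_t_derivative_def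
  by (auto intro!: derivative_eq_intros DERIV_chain2[OF assms(1)] DERIV_chain2[OF assms(2)])

lemma strip_continuous_travelling_waves:
  assumes "continuous_on UNIV a" "continuous_on UNIV b"
  shows "strip_continuous T (\<lambda>x t. a (x + t) + b (x - t))"
    and "strip_continuous T (\<lambda>x t. a (x + t) - b (x - t))"
  by (auto intro!: strip_continuousI continuous_intros
      continuous_on_compose2[OF assms(1)] continuous_on_compose2[OF assms(2)])

lemma DERIV_continuous_on_UNIV:
  assumes "\<And>x. (h has_real_derivative h' x) (at x)"
  shows "continuous_on UNIV h"
  using assms by (meson DERIV_isCont continuous_at_imp_continuous_on)

text \<open>In \<open>utt\<close> and \<open>uxx\<close> the Duhamel parts share the term
  \<open>wave_x G'\<close> and the free parts coincide, so the difference is \<open>G\<close>. The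
  single function \<open>uxt\<close> serves as mixed derivative in both orders.\<close>

lemma classical_solution_from_source:
  fixes p q A B T :: real and a a' a'' b b' b'' :: "real \<Rightarrow> real"
  assumes T: "T > 0"
    and a: "\<And>x. (a has_real_derivative a' x) (at x)" "\<And>x. (a' has_real_derivative a'' x) (at x)"
      "continuous_on UNIV a''"
    and b: "\<And>x. (b has_real_derivative b' x) (at x)" "\<And>x. (b' has_real_derivative b'' x) (at x)"
      "continuous_on UNIV b''"
    and G: "strip_continuous T G" "strip_continuous T G'" "has_x_derivative T G G'"
    and eq: "\<And>x t. t \<in> {0..T} \<Longrightarrow> G x t =
        A * \<bar>a' (x + t) - b' (x - t) + wave_t G x t\<bar> powr p
      + B * \<bar>a (x + t) + b (x - t) + wave G x t\<bar> powr q"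
  shows "classical_solution p q A B (\<lambda>x. a x + b x) (\<lambda>x. a' x - b' x) T
    (\<lambda>x t. a (x + t) + b (x - t) + wave G x t)"
proof -
  note cont = DERIV_continuous_on_UNIV[OF a(1)] DERIV_continuous_on_UNIV[OF b(1)]
    DERIV_continuous_on_UNIV[OF a(2)] DERIV_continuous_on_UNIV[OF b(2)] a(3) b(3)
  define u where "u = (\<lambda>x t. a (x + t) + b (x - t) + wave G x t)"
  define ux where "ux = (\<lambda>x t. a' (x + t) + b' (x - t) + wave_x G x t)"
  define ut where "ut = (\<lambda>x t. a' (x + t) - b' (x - t) + wave_t G x t)"
  define uxx where "uxx = (\<lambda>x t. a'' (x + t) + b'' (x - t) + wave_x G' x t)"
  define uxt where "uxt = (\<lambda>x t. a'' (x + t) - b'' (x - t) + wave_t G' x t)"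
  define utt where "utt = (\<lambda>x t. a'' (x + t) + b'' (x - t) + (G x t + wave_x G' x t))"
  note defs = u_def ux_def ut_def uxx_def uxt_def utt_def
  have sc: "strip_continuous T u" "strip_continuous T ux" "strip_continuous T ut"
    "strip_continuous T uxx" "strip_continuous T uxt" "strip_continuous T utt"
    unfolding defs
    by (intro strip_continuous_add strip_continuous_travelling_waves cont
        strip_continuous_wave strip_continuous_wave_x strip_continuous_wave_t G)+
  have x: "has_x_derivative T u ux" "has_x_derivative T ux uxx" "has_x_derivative T ut uxt"
    unfolding defs
    by (intro has_x_derivative_add travelling_waves a b has_x_derivative_wave[OF G]
        has_x_derivative_wave_x[OF G] has_x_derivative_wave_t[OF G])+
  have t: "has_t_derivative T u ut" "has_t_derivative T ux uxt" "has_t_derivative T ut utt"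
    unfolding defs
    by (intro has_t_derivative_add travelling_waves a b has_t_derivative_wave[OF G]
        has_t_derivative_wave_x[OF G] has_t_derivative_wave_t[OF G])+
  have C0: "C_k_strip 0 T w" if "strip_continuous T w" for w
    using that by (simp add: strip_continuous_def)
  have "C_k_strip (Suc (Suc 0)) T u"
    by (intro C_k_strip_SucI[OF T _ x(1) t(1)] C_k_strip_SucI[OF T _ x(2) t(2)]
        C_k_strip_SucI[OF T _ x(3) t(3)] C0 sc)
  then have C2: "C_k_strip 2 T u" by (simp add: numeral_2_eq_2)
  have ut: "dt T u x t = ut x t" if "t \<in> {0..T}" for x t
    by (rule dt_eq[OF T t(1) that])
  have "dt T (dt T u) x t - dx (dx u) x t = A * \<bar>dt T u x t\<bar> powr p + B * \<bar>u x t\<bar> powr q"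
    if s: "t \<in> {0..T}" for x t
  proof -
    have "dt T (dt T u) x t = dt T ut x t" by (rule dt_cong[OF ut s])
    also have "\<dots> = utt x t" by (rule dt_eq[OF T t(3) s])
    finally have tt: "dt T (dt T u) x t = utt x t" .
    have "dx (dx u) x t = dx ux x t"
      unfolding dx_def[of "dx u"] using dx_eq[OF x(1) s] by (simp add: dx_def[of ux])
    also have "\<dots> = uxx x t" by (rule dx_eq[OF x(2) s])
    finally have "dt T (dt T u) x t - dx (dx u) x t = G x t"
      by (simp add: tt utt_def uxx_def)
    also have "\<dots> = A * \<bar>ut x t\<bar> powr p + B * \<bar>u x t\<bar> powr q"
      using eq[OF s, of x] by (simp add: ut_def u_def)
    finally show ?thesis by (simp only: ut[OF s])
  qed
  moreover have "u x 0 = a x + b x" "dt T u x 0 = a' x - b' x" for x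
    using ut[of 0 x] T
    by (simp_all add: u_def ut_def wave_def wave_t_def char_int_def)
  ultimately show ?thesis
    using C2 unfolding classical_solution_def u_def[symmetric] by blast
qed

subsection \<open>Bounds near the light cone and in the interior\<close>

text \<open>Charges a short passage through the strip by its duration \<open>b - a\<close> instead
  of by \<open>t\<close>; the window may stick out of \<open>{0..t}\<close>.\<close>

lemma integral_window_bound:
  fixes h :: "real \<Rightarrow> real"
  assumes "continuous_on {0..t} h" "0 \<le> t" "a \<le> b" "0 \<le> c"
    and bound: "\<And>s. s \<in> {0..t} \<Longrightarrow> h s \<le> d + (if s \<in> {a..b} then c else 0)"
  shows "integral {0..t} h \<le> d * t + c * (b - a)"
proof -
  have window: "((\<lambda>s. if s \<in> {a..b} then c else 0) has_integral
      c * measure lborel ({a..b} \<inter> {0..t})) {0..t}"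
  proof -
    have "{a..b} \<inter> {0..t} = {max a 0..min b t}" by auto
    then show ?thesis
      using has_integral_const_real[of c "max a 0" "min b t"]
      by (subst has_integral_restrict_Int) (simp add: mult.commute)
  qed
  have "((\<lambda>s. d + (if s \<in> {a..b} then c else 0)) has_integral
      d * t + c * measure lborel ({a..b} \<inter> {0..t})) {0..t}"
    using has_integral_add[OF has_integral_const_real[of d 0 t] window] assms(2)
    by (simp add: mult.commute)
  then have "integral {0..t} h \<le> d * t + c * measure lborel ({a..b} \<inter> {0..t})"
    using has_integral_le[OF integrable_integral[OF integrable_continuous_real[OF assms(1)]]] bound
    by blast
  also have "measure lborel ({a..b} \<inter> {0..t}) \<le> b - a"
  proof -
    have "{a..b} \<inter> {0..t} = {max a 0..min b t}" by auto
    then show ?thesis using assms(3) by (cases "max a 0 \<le> min b t") auto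
  qed
  finally show ?thesis using assms(4) by (simp add: mult_left_mono)
qed

text \<open>
  A nonnegative function carried by the light cone \<open>\<bar>x\<bar> \<le> t + R\<close>, bounded by \<open>\<delta>\<close> outside the open
  region \<open>\<bar>x\<bar> < t - R\<close>, from which the free solution has departed by Huygens' principle,
  and by \<open>\<kappa>\<close> inside that region.
\<close>

definition cone_bounded ::
  "real \<Rightarrow> real \<Rightarrow> real \<Rightarrow> real \<Rightarrow> (real \<Rightarrow> real \<Rightarrow> real) \<Rightarrow> bool" where
  "cone_bounded T R \<delta> \<kappa> F \<longleftrightarrow> (\<forall>x. \<forall>t\<in>{0..T}. 0 \<le> F x t \<and>
     (t + R < \<bar>x\<bar> \<longrightarrow> F x t = 0) \<and>
     (t - R \<le> \<bar>x\<bar> \<longrightarrow> F x t \<le> \<delta>) \<and>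
     (\<bar>x\<bar> < t - R \<longrightarrow> F x t \<le> \<kappa>))"

lemma cone_boundedD:
  assumes "cone_bounded T R \<delta> \<kappa> F" "t \<in> {0..T}"
  shows "0 \<le> F x t" "t + R < \<bar>x\<bar> \<Longrightarrow> F x t = 0"
    "t - R \<le> \<bar>x\<bar> \<Longrightarrow> F x t \<le> \<delta>" "\<bar>x\<bar> < t - R \<Longrightarrow> F x t \<le> \<kappa>"
  using assms unfolding cone_bounded_def by blast+

lemma char_int_nonneg:
  assumes "strip_continuous T F" "\<And>x t. t \<in> {0..T} \<Longrightarrow> 0 \<le> F x t" "t \<in> {0..T}"
  shows "0 \<le> char_int \<sigma> F x t"
  unfolding char_int_def
  by (intro integral_nonneg char_int_integrable assms(1,3)) (use assms in auto)

text \<open>Traced backwards from a point with \<open>t - R \<le> \<bar>x\<bar>\<close>, a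
  characteristic never enters the interior but may stay in the strip throughout, which costs
  \<open>T * \<delta>\<close>. Traced from an interior point it lies in the strip only during a time
  interval of length \<open>R\<close>.\<close>

lemma char_int_cone_bounded:
  assumes F: "strip_continuous T F" "cone_bounded T R \<delta> \<kappa> F" and R: "R > 0"
    and nonneg: "\<delta> \<ge> 0" "\<kappa> \<ge> 0" and \<sigma>: "\<sigma> = 1 \<or> \<sigma> = -1"
  shows "cone_bounded T R (T * \<delta>) (R * \<delta> + T * \<kappa>) (char_int \<sigma> F)"
  unfolding cone_bounded_def
proof (intro allI ballI conjI impI)
  fix x t assume t: "t \<in> {0..T}"
  let ?h = "\<lambda>s. F (x + \<sigma> * (t - s)) s"
  note cont = char_int_integrand_continuous[OF F(1) t, of x \<sigma>]
  have ts: "s \<in> {0..T}" if "s \<in> {0..t}" for s using that t by auto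
  show "0 \<le> char_int \<sigma> F x t"
    by (rule char_int_nonneg[OF F(1) cone_boundedD(1)[OF F(2)] t])
  show "char_int \<sigma> F x t = 0" if "t + R < \<bar>x\<bar>"
  proof -
    have "integral {0..t} ?h = integral {0..t} (\<lambda>s. 0)"
      by (rule integral_cong) (use that \<sigma> in \<open>auto intro!: cone_boundedD(2)[OF F(2) ts]\<close>)
    then show ?thesis by (simp add: char_int_def)
  qed
  show "char_int \<sigma> F x t \<le> T * \<delta>" if out: "t - R \<le> \<bar>x\<bar>"
  proof -
    have "integral {0..t} ?h \<le> \<delta> * t + 0 * (0 - 0)"
    proof (rule integral_window_bound[OF cont])
      fix s assume "s \<in> {0..t}"
      with out \<sigma> show "?h s \<le> \<delta> + (if s \<in> {0..0} then 0 else 0)"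
        by (auto intro!: cone_boundedD(3)[OF F(2) ts])
    qed (use t in auto)
    also have "\<dots> \<le> T * \<delta>" using t nonneg mult_right_mono[of t T \<delta>] by (simp add: mult.commute)
    finally show ?thesis by (simp add: char_int_def)
  qed
  show "char_int \<sigma> F x t \<le> R * \<delta> + T * \<kappa>" if inside: "\<bar>x\<bar> < t - R"
  proof -
    \<comment> \<open>\<open>\<xi>\<close> is constant along the characteristic, whose position at
      time \<open>s\<close> has modulus \<open>\<bar>\<xi> - s\<bar>\<close>. Since
      \<open>\<xi> > R\<close>, it cannot run alongside the strip: it can be there only for
      \<open>s\<close> between \<open>(\<xi> - R) / 2\<close> and
      \<open>(\<xi> + R) / 2\<close>.\<close>
    define \<xi> where "\<xi> = t + \<sigma> * x"
    have \<xi>: "\<xi> > R" using inside \<sigma> by (auto simp: \<xi>_def)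
    have "integral {0..t} ?h \<le> \<kappa> * t + \<delta> * ((\<xi> + R) / 2 - (\<xi> - R) / 2)"
    proof (rule integral_window_bound[OF cont])
      fix s assume s: "s \<in> {0..t}"
      have abs: "\<bar>x + \<sigma> * (t - s)\<bar> = \<bar>\<xi> - s\<bar>" using \<sigma> by (auto simp: \<xi>_def)
      consider "\<bar>\<xi> - s\<bar> < s - R" | "s + R < \<bar>\<xi> - s\<bar>" | "s - R \<le> \<bar>\<xi> - s\<bar>" "\<bar>\<xi> - s\<bar> \<le> s + R"
        by linarith
      then show "?h s \<le> \<kappa> + (if s \<in> {(\<xi> - R) / 2..(\<xi> + R) / 2} then \<delta> else 0)"
      proof cases
        case 1
        then show ?thesis using cone_boundedD(4)[OF F(2) ts[OF s], of "x + \<sigma> * (t - s)"] abs nonneg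
          by auto
      next
        case 2
        then show ?thesis using cone_boundedD(2)[OF F(2) ts[OF s], of "x + \<sigma> * (t - s)"] abs nonneg
          by auto
      next
        case 3
        then have "s \<in> {(\<xi> - R) / 2..(\<xi> + R) / 2}" using \<xi> by (auto simp: abs_if split: if_splits)
        then show ?thesis
          using 3 cone_boundedD(3)[OF F(2) ts[OF s], of "x + \<sigma> * (t - s)"] abs nonneg by auto
      qed
    qed (use t R nonneg in auto)
    also have "\<dots> = R * \<delta> + t * \<kappa>" by (simp add: field_simps)
    also have "\<dots> \<le> R * \<delta> + T * \<kappa>" using t nonneg by (simp add: mult_right_mono)
    finally show ?thesis by (simp add: char_int_def)
  qed
qed

lemma wave_t_cone_bounded:
  assumes "strip_continuous T F" "cone_bounded T R \<delta> \<kappa> F" "R > 0" "\<delta> \<ge> 0" "\<kappa> \<ge> 0"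
  shows "cone_bounded T R (T * \<delta>) (R * \<delta> + T * \<kappa>) (wave_t F)"
  using char_int_cone_bounded[OF assms, of 1] char_int_cone_bounded[OF assms, of "- 1"]
  unfolding cone_bounded_def wave_t_def by fastforce

text \<open>A vertical line meets the strip between the two regions only during a time interval of length \<open>2 * R\<close>.\<close>

lemma vertical_cone_bounded:
  assumes F: "strip_continuous T F" "cone_bounded T R \<delta> \<kappa> F" and R: "R > 0"
    and nonneg: "\<delta> \<ge> 0" "\<kappa> \<ge> 0"
  shows "cone_bounded T R (2 * R * \<delta>) (2 * R * \<delta> + T * \<kappa>) (char_int 0 F)"
  unfolding cone_bounded_def
proof (intro allI ballI conjI impI)
  fix x t assume t: "t \<in> {0..T}"
  have cont: "continuous_on {0..t} (F x)"
    using char_int_integrand_continuous[OF F(1) t, of x 0] by simp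
  have ts: "s \<in> {0..T}" if "s \<in> {0..t}" for s using that t by auto
  have char: "char_int 0 F x t = integral {0..t} (F x)" by (simp add: char_int_def)
  show "0 \<le> char_int 0 F x t"
    by (rule char_int_nonneg[OF F(1) cone_boundedD(1)[OF F(2)] t])
  show "char_int 0 F x t = 0" if "t + R < \<bar>x\<bar>"
  proof -
    have "integral {0..t} (F x) = integral {0..t} (\<lambda>s. 0)"
      by (rule integral_cong) (use that in \<open>auto intro!: cone_boundedD(2)[OF F(2) ts]\<close>)
    then show ?thesis by (simp add: char)
  qed
  have window: "integral {0..t} (F x) \<le> d * t + \<delta> * ((\<bar>x\<bar> + R) - (\<bar>x\<bar> - R))"
    if d: "d \<ge> 0" "\<And>s. s \<in> {0..t} \<Longrightarrow> \<bar>x\<bar> < s - R \<Longrightarrow> F x s \<le> d" for d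
  proof (rule integral_window_bound[OF cont])
    fix s assume s: "s \<in> {0..t}"
    consider "\<bar>x\<bar> < s - R" | "s + R < \<bar>x\<bar>" | "s - R \<le> \<bar>x\<bar>" "\<bar>x\<bar> \<le> s + R"
      by linarith
    then show "F x s \<le> d + (if s \<in> {\<bar>x\<bar> - R..\<bar>x\<bar> + R} then \<delta> else 0)"
    proof cases
      case 1
      then show ?thesis using d(2)[OF s] nonneg by auto
    next
      case 2
      then show ?thesis using cone_boundedD(2)[OF F(2) ts[OF s], of x] d(1) nonneg by auto
    next
      case 3
      then have "s \<in> {\<bar>x\<bar> - R..\<bar>x\<bar> + R}" by auto
      then show ?thesis using 3 cone_boundedD(3)[OF F(2) ts[OF s], of x] d(1) by auto
    qed
  qed (use t R nonneg in auto)
  \<comment> \<open>\<open>d = 0\<close> is admissible: \<open>\<bar>x\<bar> < s - R\<close> with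
    \<open>s \<le> t\<close> would contradict \<open>t - R \<le> \<bar>x\<bar>\<close>.\<close>
  show "char_int 0 F x t \<le> 2 * R * \<delta>" if "t - R \<le> \<bar>x\<bar>"
    using window[of 0] that by (auto simp: char algebra_simps)
  show "char_int 0 F x t \<le> 2 * R * \<delta> + T * \<kappa>" if "\<bar>x\<bar> < t - R"
  proof -
    have "integral {0..t} (F x) \<le> \<kappa> * t + \<delta> * ((\<bar>x\<bar> + R) - (\<bar>x\<bar> - R))"
      by (rule window) (use nonneg in \<open>auto intro!: cone_boundedD(4)[OF F(2) ts]\<close>)
    also have "\<dots> = 2 * R * \<delta> + t * \<kappa>" by (simp add: algebra_simps)
    also have "\<dots> \<le> 2 * R * \<delta> + T * \<kappa>" using t nonneg by (simp add: mult_right_mono)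
    finally show ?thesis by (simp add: char)
  qed
qed

text \<open>One closed step of the iteration. \<open>E\<close> bounds the free solution and
  \<open>e\<close> the correction to \<open>u_t\<close> near the cone; in the interior the free
  solution is absent, so the source sees only \<open>N\<close> and \<open>2 * T * N\<close>. The
  third conclusion is the invariance, the first two yield the uniform bound for the Picard
  scheme.\<close>

lemma wave_source_cone_bounded:
  fixes \<phi> \<psi> :: "real \<Rightarrow> real"
  assumes F: "strip_continuous T F" "cone_bounded T R \<delta> (\<phi> N + \<psi> (2 * T * N)) F"
    and R: "R > 0" and T: "T > 0" and \<delta>: "\<delta> \<ge> 0" and N: "N = 2 * R * \<delta>"
    and \<phi>: "\<phi> 0 = 0" "\<And>s r. \<bar>s\<bar> \<le> r \<Longrightarrow> 0 \<le> \<phi> s \<and> \<phi> s \<le> \<phi> r"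
    and \<psi>: "\<psi> 0 = 0" "\<And>s r. \<bar>s\<bar> \<le> r \<Longrightarrow> 0 \<le> \<psi> s \<and> \<psi> s \<le> \<psi> r"
    and u0: "\<And>x t. t \<in> {0..T} \<Longrightarrow> \<bar>u0 x t\<bar> \<le> E"
      "\<And>x t. t \<in> {0..T} \<Longrightarrow> t + R < \<bar>x\<bar> \<or> \<bar>x\<bar> < t - R \<Longrightarrow> u0 x t = 0"
    and v0: "\<And>x t. t \<in> {0..T} \<Longrightarrow> \<bar>v0 x t\<bar> \<le> E"
      "\<And>x t. t \<in> {0..T} \<Longrightarrow> t + R < \<bar>x\<bar> \<or> \<bar>x\<bar> < t - R \<Longrightarrow> v0 x t = 0"
    and strip: "T * \<delta> \<le> e" "\<phi> (E + e) + \<psi> (E + 2 * R * e) \<le> \<delta>"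
    and interior: "T * (\<phi> N + \<psi> (2 * T * N)) \<le> N / 2"
  shows "cone_bounded T R e N (wave_t F)" "cone_bounded T R (2 * R * e) (2 * T * N) (wave F)"
    "cone_bounded T R \<delta> (\<phi> N + \<psi> (2 * T * N)) (wave_source \<phi> \<psi> u0 v0 F)"
proof -
  have N0: "N \<ge> 0" using R \<delta> N by simp
  have "\<phi> N + \<psi> (2 * T * N) \<ge> 0"
    using \<phi>(2)[of 0 N] \<psi>(2)[of 0 "2 * T * N"] \<phi>(1) \<psi>(1) N0 T by simp
  note wt = wave_t_cone_bounded[OF F R \<delta> this]
  \<comment> \<open>Crossing the strip uses up \<open>R * \<delta> = N / 2\<close>; the assumption
    \<open>interior\<close> takes the other half.\<close>
  have "R * \<delta> + T * (\<phi> N + \<psi> (2 * T * N)) \<le> N" using interior by (simp add: N)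
  with wt have wt': "cone_bounded T R (T * \<delta>) N (wave_t F)"
    unfolding cone_bounded_def by fastforce
  with strip(1) show wt'': "cone_bounded T R e N (wave_t F)"
    unfolding cone_bounded_def by fastforce
  \<comment> \<open>Near the cone the vertical integral costs \<open>2 * R\<close> and no further
    \<open>T\<close>. In the interior the strip contributes
    \<open>2 * R * (T * \<delta>) = T * N\<close>, as much as the interior itself, whence
    \<open>2 * T * N\<close>.\<close>
  have "cone_bounded T R (2 * R * (T * \<delta>)) (2 * R * (T * \<delta>) + T * N) (wave F)"
    unfolding wave_def
    by (rule vertical_cone_bounded[OF strip_continuous_wave_t[OF F(1)] wt' R]) (use T \<delta> N0 in auto)
  moreover have "2 * R * (T * \<delta>) \<le> 2 * R * e" using strip(1) R by simp
  moreover have "2 * R * (T * \<delta>) + T * N = 2 * T * N" by (simp add: N)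
  ultimately show w: "cone_bounded T R (2 * R * e) (2 * T * N) (wave F)"
    unfolding cone_bounded_def by fastforce
  show "cone_bounded T R \<delta> (\<phi> N + \<psi> (2 * T * N)) (wave_source \<phi> \<psi> u0 v0 F)"
    unfolding cone_bounded_def wave_source_def
  proof (intro allI ballI conjI impI)
    fix x t assume t: "t \<in> {0..T}"
    let ?v = "v0 x t + wave_t F x t" and ?u = "u0 x t + wave F x t"
    show "0 \<le> \<phi> ?v + \<psi> ?u"
      using \<phi>(2)[of ?v "\<bar>?v\<bar>"] \<psi>(2)[of ?u "\<bar>?u\<bar>"] by simp
    show "\<phi> ?v + \<psi> ?u = 0" if "t + R < \<bar>x\<bar>"
      using that u0(2)[OF t] v0(2)[OF t] cone_boundedD(2)[OF wt'' t] cone_boundedD(2)[OF w t] \<phi>(1) \<psi>(1)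
      by simp
    show "\<phi> ?v + \<psi> ?u \<le> \<delta>" if "t - R \<le> \<bar>x\<bar>"
    proof -
      have "\<bar>?v\<bar> \<le> E + e"
        using cone_boundedD(1)[OF wt'' t, of x] cone_boundedD(3)[OF wt'' t, of x] v0(1)[OF t, of x] that
        by linarith
      moreover have "\<bar>?u\<bar> \<le> E + 2 * R * e"
        using cone_boundedD(1)[OF w t, of x] cone_boundedD(3)[OF w t, of x] u0(1)[OF t, of x] that
        by linarith
      ultimately have "\<phi> ?v + \<psi> ?u \<le> \<phi> (E + e) + \<psi> (E + 2 * R * e)"
        using \<phi>(2) \<psi>(2) by (intro add_mono) auto
      with strip(2) show ?thesis by linarith
    qed
    show "\<phi> ?v + \<psi> ?u \<le> \<phi> N + \<psi> (2 * T * N)" if "\<bar>x\<bar> < t - R"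
    proof -
      have "\<bar>?v\<bar> \<le> N"
        using cone_boundedD(1)[OF wt'' t, of x] cone_boundedD(4)[OF wt'' t, of x] v0(2)[OF t, of x] that
        by auto
      moreover have "\<bar>?u\<bar> \<le> 2 * T * N"
        using cone_boundedD(1)[OF w t, of x] cone_boundedD(4)[OF w t, of x] u0(2)[OF t, of x] that
        by auto
      ultimately show ?thesis using \<phi>(2) \<psi>(2) by (intro add_mono) auto
    qed
  qed
qed

subsection \<open>Powers, initial data and constants\<close>

text \<open>This is \<open>p * sgn s * \<bar>s\<bar> powr (p - 1)\<close>. Positive and negative
  parts make continuity at 0 evident; away from 0 one of the two terms is
  \<open>0 powr (p - 1) = 0\<close>.\<close>

definition abs_powr_deriv :: "real \<Rightarrow> real \<Rightarrow> real" where
  "abs_powr_deriv p s = p * (max s 0 powr (p - 1) - max (- s) 0 powr (p - 1))"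

lemma continuous_abs_powr_deriv:
  assumes "p > 1"
  shows "continuous_on UNIV (abs_powr_deriv p)"
  unfolding abs_powr_deriv_def using assms
  by (intro continuous_intros continuous_on_powr') auto

text \<open>Away from 0 this is the power rule for a positive base; at 0 the difference quotient is
  dominated by \<open>\<bar>h\<bar> powr (p - 1)\<close>, which tends to 0 as
  \<open>p > 1\<close>.\<close>

lemma abs_powr_has_derivative:
  assumes p: "p > 1"
  shows "((\<lambda>s. \<bar>s\<bar> powr p) has_real_derivative abs_powr_deriv p s) (at s)"
proof -
  consider "s > 0" | "s < 0" | "s = 0" by linarith
  then show ?thesis
  proof cases
    case 1
    have "((\<lambda>s. s powr p) has_real_derivative p * s powr (p - 1)) (at s)"
      by (rule has_real_derivative_powr[OF 1])
    moreover have ev: "eventually (\<lambda>y. y powr p = \<bar>y\<bar> powr p) (nhds s)"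
      using eventually_nhds_in_open[of "{0<..}" s] 1 by (auto elim: eventually_mono)
    ultimately have "((\<lambda>s. \<bar>s\<bar> powr p) has_real_derivative p * s powr (p - 1)) (at s)"
      using DERIV_cong_ev[OF refl ev refl] by blast
    then show ?thesis using 1 by (simp add: abs_powr_deriv_def max_def)
  next
    case 2
    have "((\<lambda>s. (- s) powr p) has_real_derivative p * (- s) powr (p - 1) * (- 1)) (at s)"
    proof (rule DERIV_chain2[where f = "\<lambda>z. z powr p" and g = uminus])
      show "((\<lambda>z. z powr p) has_real_derivative p * (- s) powr (p - 1)) (at (- s))"
        by (rule has_real_derivative_powr) (use 2 in simp)
    qed (auto intro!: derivative_eq_intros)
    moreover have ev: "eventually (\<lambda>y. (- y) powr p = \<bar>y\<bar> powr p) (nhds s)"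
      using eventually_nhds_in_open[of "{..<0}" s] 2 by (auto elim: eventually_mono)
    ultimately have "((\<lambda>s. \<bar>s\<bar> powr p) has_real_derivative p * (- s) powr (p - 1) * (- 1)) (at s)"
      using DERIV_cong_ev[OF refl ev refl] by blast
    then show ?thesis using 2 by (simp add: abs_powr_deriv_def max_def)
  next
    case 3
    have "((\<lambda>h. \<bar>h\<bar> powr (p - 1)) \<longlongrightarrow> \<bar>0\<bar> powr (p - 1)) (at (0::real))"
      using p by (intro tendsto_powr' tendsto_intros) auto
    then have "((\<lambda>h. \<bar>h\<bar> powr (p - 1)) \<longlongrightarrow> 0) (at (0::real))" by simp
    then have "((\<lambda>h. \<bar>h\<bar> powr p / h) \<longlongrightarrow> 0) (at (0::real))"
    proof (rule Lim_null_comparison[rotated])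
      have "norm (\<bar>h\<bar> powr p / h) \<le> \<bar>h\<bar> powr (p - 1)" for h :: real
        by (cases "h = 0") (auto simp: abs_divide powr_diff)
      then show "\<forall>\<^sub>F h in at 0. norm (\<bar>h\<bar> powr p / h) \<le> \<bar>h\<bar> powr (p - 1)"
        by simp
    qed
    then show ?thesis using 3 p by (simp add: DERIV_def abs_powr_deriv_def)
  qed
qed

section \<open>Compactly supported profiles of the free solution\<close>

lemma continuous_vanishing_bounded:
  fixes h :: "real \<Rightarrow> real"
  assumes "continuous_on UNIV h" "\<And>x. \<bar>x\<bar> > R \<Longrightarrow> h x = 0"
  obtains B where "B > 0" "\<And>x. \<bar>h x\<bar> \<le> B"
proof -
  obtain B where B: "B > 0" "\<And>s. \<bar>s\<bar> \<le> R \<Longrightarrow> \<bar>h s\<bar> \<le> B"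
    using continuous_bounded_interval[OF assms(1)] by blast
  have "\<bar>h x\<bar> \<le> B" for x
    using B assms(2)[of x] by (cases "\<bar>x\<bar> \<le> R") auto
  with B(1) show ?thesis by (rule that)
qed

lemma derivative_vanishes_outside:
  fixes h :: "real \<Rightarrow> real"
  assumes "(h has_real_derivative d) (at x)" "\<And>x. \<bar>x\<bar> > R \<Longrightarrow> h x = 0" "\<bar>x\<bar> > R"
  shows "d = 0"
proof -
  have "open {x::real. \<bar>x\<bar> > R}"
    by (intro open_Collect_less continuous_intros)
  then have "eventually (\<lambda>y. h y = 0) (nhds x)"
    using eventually_nhds_in_open[of "{x. \<bar>x\<bar> > R}" x] assms(2,3) by (auto elim: eventually_mono)
  then have "((\<lambda>y. 0) has_real_derivative d) (at x)"
    using assms(1) DERIV_cong_ev[OF refl _ refl, of h "\<lambda>y. 0" x d] by simp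
  then show ?thesis using DERIV_unique[OF _ DERIV_const] by blast
qed

lemma vanishes_outside_supp:
  assumes "supp f \<subseteq> {x. \<bar>x\<bar> \<le> R}" "\<bar>x\<bar> > R"
  shows "f x = 0"
proof (rule ccontr)
  assume "f x \<noteq> 0"
  then have "x \<in> supp f"
    unfolding supp_def by (intro closure_subset[THEN subsetD]) (simp add: support_on_def)
  with assms show False by auto
qed

text \<open>The mean-zero condition enters here: the primitive that vanishes on the left returns to
  0 beyond \<open>R\<close>.\<close>

lemma compactly_supported_primitive:
  fixes g :: "real \<Rightarrow> real"
  assumes g: "continuous_on UNIV g" "\<And>x. \<bar>x\<bar> > R \<Longrightarrow> g x = 0" and R: "R \<ge> 0"
    and int: "(LBINT x. g x) = 0"
  obtains P where "\<And>x. (P has_real_derivative g x) (at x)" "\<And>x. \<bar>x\<bar> > R \<Longrightarrow> P x = 0"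
proof -
  \<comment> \<open>Starting one unit to the left of \<open>- R\<close> makes every
    \<open>x \<ge> - R\<close> an inner point of an interval of integration, so the derivative there
    is two-sided.\<close>
  define P where "P x = integral {- (R + 1)..x} g" for x
  have cont: "continuous_on S g" for S by (rule continuous_on_subset[OF g(1)]) simp
  have left: "P x = 0" if "x < - R" for x
  proof -
    have "integral {- (R + 1)..x} g = integral {- (R + 1)..x} (\<lambda>x. 0)"
      by (rule integral_cong) (use that R in \<open>auto intro!: g(2)\<close>)
    then show ?thesis by (simp add: P_def)
  qed
  have total: "integral {- R..R} g = 0"
  proof -
    have "set_integrable lborel {- R..R} g"
      by (rule borel_integrable_atLeastAtMost') (rule cont)
    then have "integral {- R..R} g = (LINT x : {- R..R} | lborel. g x)"
      by (rule set_borel_integral_eq_integral(2)[symmetric])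
    also have "\<dots> = (LBINT x. g x)"
      unfolding set_lebesgue_integral_def
    proof (rule Bochner_Integration.integral_cong)
      show "indicator {- R..R} x *\<^sub>R g x = g x" for x
        using g(2)[of x] by (cases "x \<in> {- R..R}") auto
    qed simp
    finally show ?thesis using int by simp
  qed
  have right: "P x = 0" if "x > R" for x
  proof -
    have "P x = integral {- (R + 1)..- R} g + (integral {- R..R} g + integral {R..x} g)"
      unfolding P_def using that R Henstock_Kurzweil_Integration.integral_combine[where f = g and a = "- (R + 1)" and c = "- R" and b = x]
        Henstock_Kurzweil_Integration.integral_combine[where f = g and a = "- R" and c = R and b = x] integrable_continuous_real[OF cont] by simp
    \<comment> \<open>\<open>g\<close> is known to vanish only for \<open>\<bar>x\<bar> > R\<close>;
      the endpoint is discarded as a null set.\<close>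
    moreover have "integral {- (R + 1)..- R} g = integral {- (R + 1)..- R} (\<lambda>x. 0)"
      by (rule integral_spike[of "{- R}"]) (use R in \<open>auto intro!: g(2)\<close>)
    moreover have "integral {R..x} g = integral {R..x} (\<lambda>x. 0)"
      by (rule integral_spike[of "{R}"]) (use R in \<open>auto intro!: g(2)\<close>)
    ultimately show ?thesis by (simp add: total)
  qed
  have "(P has_real_derivative g x) (at x)" for x
  proof (cases "x < - R")
    case True
    have "eventually (\<lambda>y. P y = 0) (nhds x)"
      using eventually_nhds_in_open[of "{..<- R}" x] True by (auto elim: eventually_mono intro: left)
    then have "(P has_real_derivative 0) (at x)"
      using DERIV_cong_ev[OF refl _ refl, of P "\<lambda>y. 0" x 0] by simp
    then show ?thesis using g(2)[of x] True R by simp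
  next
    case False
    have "(P has_real_derivative g x) (at x within {- (R + 1)..x + 1})"
      unfolding P_def by (rule integral_has_real_derivative[OF cont]) (use False in auto)
    moreover have "at x within {- (R + 1)..x + 1} = at x"
      by (rule at_within_Icc_at) (use False in auto)
    ultimately show ?thesis by simp
  qed
  moreover have "P x = 0" if "\<bar>x\<bar> > R" for x
    using left[of x] right[of x] that by (cases "x < 0") auto
  ultimately show ?thesis by (rule that)
qed

text \<open>
  D'Alembert's splitting of the free solution: because \<open>g\<close> has mean zero, both travelling profiles
  are compactly supported.
\<close>

lemma travelling_profiles:
  assumes f: "C_k_compact_support 2 f" "supp f \<subseteq> {x. \<bar>x\<bar> \<le> R}"
    and g: "C_k_compact_support 1 g" "supp g \<subseteq> {x. \<bar>x\<bar> \<le> R}"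
    and R: "R \<ge> 0" and int: "(LBINT x. g x) = 0"
  obtains a a' a'' b b' b'' :: "real \<Rightarrow> real" and C where
    "\<And>x. (a has_real_derivative a' x) (at x)" "\<And>x. (a' has_real_derivative a'' x) (at x)"
    "continuous_on UNIV a''"
    "\<And>x. (b has_real_derivative b' x) (at x)" "\<And>x. (b' has_real_derivative b'' x) (at x)"
    "continuous_on UNIV b''"
    "\<And>x. \<bar>x\<bar> > R \<Longrightarrow> a x = 0" "\<And>x. \<bar>x\<bar> > R \<Longrightarrow> b x = 0"
    "\<And>x. a x + b x = f x" "\<And>x. a' x - b' x = g x"
    "C > 0" "\<And>h x. h \<in> {a, a', a'', b, b', b''} \<Longrightarrow> \<bar>h x\<bar> \<le> C"
proof -
  have deriv: "(h has_real_derivative deriv h x) (at x)" if "h differentiable_on UNIV" for h x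
    using that by (simp add: differentiable_on_def DERIV_deriv_iff_real_differentiable)
  have f': "(f has_real_derivative deriv f x) (at x)"
    and f'': "(deriv f has_real_derivative deriv (deriv f) x) (at x)" for x
    using f(1) by (auto simp: C_k_compact_support_def C_k_def numeral_2_eq_2 less_Suc_eq intro!: deriv)
  have cf: "continuous_on UNIV (deriv (deriv f))"
    using f(1) by (simp add: C_k_compact_support_def C_k_def numeral_2_eq_2)
  have g': "(g has_real_derivative deriv g x) (at x)" for x
    using g(1) by (auto simp: C_k_compact_support_def C_k_def intro!: deriv)
  have cg: "continuous_on UNIV (deriv g)"
    using g(1) by (simp add: C_k_compact_support_def C_k_def)
  obtain P where P: "\<And>x. (P has_real_derivative g x) (at x)" "\<And>x. \<bar>x\<bar> > R \<Longrightarrow> P x = 0"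
    using compactly_supported_primitive[OF DERIV_continuous_on_UNIV[OF g']
        vanishes_outside_supp[OF g(2)] R int] by blast
  \<comment> \<open>D'Alembert's choice: as \<open>P\<close> is a primitive of \<open>g\<close>, the
    profiles satisfy \<open>a + b = f\<close> and \<open>a' - b' = g\<close>.\<close>
  define a a' a'' where "a x = (f x + P x) / 2" and "a' x = (deriv f x + g x) / 2"
    and "a'' x = (deriv (deriv f) x + deriv g x) / 2" for x
  define b b' b'' where "b x = (f x - P x) / 2" and "b' x = (deriv f x - g x) / 2"
    and "b'' x = (deriv (deriv f) x - deriv g x) / 2" for x
  have a: "(a has_real_derivative a' x) (at x)" "(a' has_real_derivative a'' x) (at x)" for x
    unfolding a_def a'_def a''_def by (auto intro!: DERIV_cdivide derivative_intros f' f'' g' P)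
  have b: "(b has_real_derivative b' x) (at x)" "(b' has_real_derivative b'' x) (at x)" for x
    unfolding b_def b'_def b''_def by (auto intro!: DERIV_cdivide derivative_intros f' f'' g' P)
  have c: "continuous_on UNIV a''" "continuous_on UNIV b''"
    unfolding a''_def b''_def by (intro continuous_intros cf cg; simp)+
  have a0: "a x = 0" and b0: "b x = 0" if "\<bar>x\<bar> > R" for x
    using vanishes_outside_supp[OF f(2) that] P(2)[OF that] by (simp_all add: a_def b_def)
  have a'0: "a' x = 0" and b'0: "b' x = 0" if "\<bar>x\<bar> > R" for x
    using derivative_vanishes_outside[OF a(1) a0 that] derivative_vanishes_outside[OF b(1) b0 that]
    by simp_all
  have a''0: "a'' x = 0" and b''0: "b'' x = 0" if "\<bar>x\<bar> > R" for x
    using derivative_vanishes_outside[OF a(2) a'0 that] derivative_vanishes_outside[OF b(2) b'0 that]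
    by simp_all
  have bounded: "\<exists>B>0. \<forall>x. \<bar>h x\<bar> \<le> B"
    if "continuous_on UNIV h" "\<And>x. \<bar>x\<bar> > R \<Longrightarrow> h x = 0" for h :: "real \<Rightarrow> real"
    using continuous_vanishing_bounded[of h R] that by metis
  have "\<exists>B>0. \<forall>x. \<bar>h x\<bar> \<le> B" if "h \<in> {a, a', a'', b, b', b''}" for h
    using that DERIV_continuous_on_UNIV[OF a(1)] DERIV_continuous_on_UNIV[OF a(2)] c(1)
      DERIV_continuous_on_UNIV[OF b(1)] DERIV_continuous_on_UNIV[OF b(2)] c(2)
    by (auto intro!: bounded a0 a'0 a''0 b0 b'0 b''0)
  then obtain Bd where Bd: "\<And>h. h \<in> {a, a', a'', b, b', b''} \<Longrightarrow> Bd h > 0 \<and> (\<forall>x. \<bar>h x\<bar> \<le> Bd h)"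
    by metis
  define C where "C = Max (Bd ` {a, a', a'', b, b', b''})"
  have C: "Bd h \<le> C" if "h \<in> {a, a', a'', b, b', b''}" for h
    unfolding C_def using that by (intro Max_ge finite_imageI imageI) auto
  have "a x + b x = f x" "a' x - b' x = g x" for x
    by (simp_all add: a_def b_def a'_def b'_def field_simps)
  moreover have "C > 0" using C[of a] Bd[of a] by force
  moreover have "\<bar>h x\<bar> \<le> C" if "h \<in> {a, a', a'', b, b', b''}" for h x
    using C[OF that] Bd[OF that] by (meson order_trans)
  ultimately show ?thesis using a b c a0 b0 by (intro that[of a a' a'' b b' b'' C])
qed

text \<open>
  In the application \<open>\<delta>\<close> is the size of the nonlinearity near the light cone, and the two
  smallness conditions on \<open>T\<close> keep the interior contributions of size \<open>N = 2 * R * \<delta>\<close>.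
\<close>

lemma lifespan_constants:
  fixes p q A B R E :: real
  assumes p: "p > 1" and q: "q > 1" and A: "A > 0" and B: "B > 0" and R: "R > 0" and E: "E > 0"
  defines "m \<equiv> min p q"
  obtains c K where "c > 0" "K > 0"
    "\<And>\<epsilon> T \<delta> N. 0 < \<epsilon> \<Longrightarrow> \<epsilon> \<le> 1 \<Longrightarrow> T > 0 \<Longrightarrow> \<delta> = K * \<epsilon> powr m \<Longrightarrow> N = 2 * R * \<delta> \<Longrightarrow>
      T * \<epsilon> powr (m - 1) \<le> c \<Longrightarrow> T * \<epsilon> powr (m * (q - 1) / (q + 1)) \<le> c \<Longrightarrow>
      T * \<delta> \<le> \<epsilon> \<and>
      A * (E * \<epsilon> + \<epsilon>) powr p + B * (E * \<epsilon> + 2 * R * \<epsilon>) powr q \<le> \<delta> \<and>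
      T * (A * N powr p + B * (2 * T * N) powr q) \<le> N / 2"
proof -
  \<comment> \<open>What remains of the source bound near the cone after
    \<open>\<epsilon> powr p\<close> and \<open>\<epsilon> powr q\<close> are both estimated by
    \<open>\<epsilon> powr m\<close>, using \<open>\<epsilon> \<le> 1\<close>.\<close>
  define K where "K = A * (E + 1) powr p + B * (E + 2 * R) powr q"
  define L where "L = 2 * R * K"
  \<comment> \<open>The factor 4 in \<open>X\<close> and \<open>Y\<close> gives each interior term a
    budget of \<open>N / 4\<close>; the rest is its coefficient once \<open>N\<close>,
    \<open>T\<close> and the powers of \<open>\<epsilon>\<close> are split off.\<close>
  define X where "X = 4 * A * L powr (p - 1)"
  define Y where "Y = 4 * B * 2 powr q * L powr (q - 1)"
  \<comment> \<open>The entry 1 is there for \<open>c powr (q + 1) \<le> c\<close>; the others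
    absorb \<open>K\<close>, \<open>X\<close> and \<open>Y\<close>.\<close>
  define c where "c = Min {1, 1 / K, 1 / X, 1 / Y}"
  have K: "K > 0" using A B E R by (simp add: K_def add_pos_pos)
  have L: "L > 0" using K R by (simp add: L_def)
  have X: "X > 0" and Y: "Y > 0" using A B L by (simp_all add: X_def Y_def)
  have c: "c > 0" using K X Y by (simp add: c_def)
  have "c \<le> 1 / K" "c \<le> 1 / X" "c \<le> 1 / Y" by (simp_all add: c_def)
  then have cK: "c * K \<le> 1" and cX: "c * X \<le> 1" and cY: "c * Y \<le> 1"
    using K X Y by (simp_all add: field_simps)
  have c1: "c \<le> 1" by (simp add: c_def)
  have m: "m > 1" "m \<le> p" "m \<le> q" using p q by (auto simp: m_def)
  show ?thesis
  proof (rule that[OF c K])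
    fix \<epsilon> T \<delta> N :: real
    assume \<epsilon>: "0 < \<epsilon>" "\<epsilon> \<le> 1" and T: "T > 0" and \<delta>: "\<delta> = K * \<epsilon> powr m" and N: "N = 2 * R * \<delta>"
      and T1: "T * \<epsilon> powr (m - 1) \<le> c" and T2: "T * \<epsilon> powr (m * (q - 1) / (q + 1)) \<le> c"
    have "T * \<delta> = (T * \<epsilon> powr (m - 1)) * K * \<epsilon>"
      using \<epsilon> by (simp add: \<delta> powr_diff)
    also have "\<dots> \<le> c * K * \<epsilon>"
      using T1 K \<epsilon> by (intro mult_right_mono) auto
    also have "\<dots> \<le> 1 * \<epsilon>" using cK \<epsilon> by (intro mult_right_mono) auto
    finally have 1: "T * \<delta> \<le> \<epsilon>" by simp
    have power: "(d * \<epsilon>) powr r \<le> d powr r * \<epsilon> powr m" if "d > 0" "m \<le> r" for d r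
      using that \<epsilon> by (simp add: powr_mult powr_mono' mult_left_mono)
    have "A * ((E + 1) * \<epsilon>) powr p + B * ((E + 2 * R) * \<epsilon>) powr q
        \<le> A * ((E + 1) powr p * \<epsilon> powr m) + B * ((E + 2 * R) powr q * \<epsilon> powr m)"
      using A B E R m by (intro add_mono mult_left_mono power) auto
    also have "\<dots> = \<delta>" by (simp add: \<delta> K_def algebra_simps)
    finally have 2: "A * (E * \<epsilon> + \<epsilon>) powr p + B * (E * \<epsilon> + 2 * R * \<epsilon>) powr q \<le> \<delta>"
      by (simp add: algebra_simps)
    have NL: "N = L * \<epsilon> powr m" by (simp add: N L_def \<delta>)
    have N0: "N > 0" using L \<epsilon> by (simp add: NL)
    have Nr: "N powr r = L powr (r - 1) * \<epsilon> powr (m * (r - 1)) * N" for r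
    proof -
      have "N powr r = N powr (r - 1) * N" using N0 by (simp add: powr_diff)
      also have "N powr (r - 1) = L powr (r - 1) * \<epsilon> powr (m * (r - 1))"
        using L \<epsilon> by (simp add: NL powr_mult powr_powr)
      finally show ?thesis .
    qed
    \<comment> \<open>The first smallness condition does double duty: besides the correction near
      the cone it controls the interior \<open>p\<close> term.\<close>
    have "T * \<epsilon> powr (m * (p - 1)) \<le> T * \<epsilon> powr (m - 1)"
    proof -
      have "1 * (m - 1) \<le> m * (p - 1)" using m by (intro mult_mono) auto
      then show ?thesis using \<epsilon> T by (intro mult_left_mono powr_mono') auto
    qed
    with T1 have "T * \<epsilon> powr (m * (p - 1)) \<le> c" by linarith
    then have "(T * \<epsilon> powr (m * (p - 1))) * (A * L powr (p - 1) * N) \<le> c * (A * L powr (p - 1) * N)"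
      using A N0 by (intro mult_right_mono) auto
    also have "\<dots> = (c * X) * (N / 4)" by (simp add: X_def)
    also have "\<dots> \<le> 1 * (N / 4)" using cX N0 by (intro mult_right_mono) auto
    finally have 3: "T * (A * N powr p) \<le> N / 4"
      by (simp add: Nr[of p] ac_simps)
    \<comment> \<open>Raised to the power \<open>q + 1\<close>, the second condition matches the
      \<open>T powr (q + 1)\<close> arising from \<open>T * (2 * T * N) powr q\<close>.\<close>
    have "T powr (q + 1) * \<epsilon> powr (m * (q - 1)) = (T * \<epsilon> powr (m * (q - 1) / (q + 1))) powr (q + 1)"
      using q T \<epsilon> by (simp add: powr_mult powr_powr)
    also have "\<dots> \<le> c powr (q + 1)"
      using T2 T q by (intro powr_mono2) auto
    also have "\<dots> \<le> c powr 1" using c c1 q by (intro powr_mono') auto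
    finally have "T powr (q + 1) * \<epsilon> powr (m * (q - 1)) \<le> c" using c by simp
    then have "(T powr (q + 1) * \<epsilon> powr (m * (q - 1))) * (B * 2 powr q * L powr (q - 1) * N)
        \<le> c * (B * 2 powr q * L powr (q - 1) * N)"
      using B N0 by (intro mult_right_mono) auto
    also have "\<dots> = (c * Y) * (N / 4)" by (simp add: Y_def)
    also have "\<dots> \<le> 1 * (N / 4)" using cY N0 by (intro mult_right_mono) auto
    finally have 4: "T * (B * (2 * T * N) powr q) \<le> N / 4"
      using T N0 by (simp add: powr_mult powr_add Nr[of q] ac_simps)
    from 3 4 have "T * (A * N powr p + B * (2 * T * N) powr q) \<le> N / 2"
      by (simp add: distrib_left)
    with 1 2 show "T * \<delta> \<le> \<epsilon> \<and>
      A * (E * \<epsilon> + \<epsilon>) powr p + B * (E * \<epsilon> + 2 * R * \<epsilon>) powr q \<le> \<delta> \<and>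
      T * (A * N powr p + B * (2 * T * N) powr q) \<le> N / 2" by blast
  qed
qed

text \<open>The profiles already carry their amplitude in \<open>C\<close>, so \<open>2 * C\<close>
  bounds the free solution; \<open>\<epsilon>\<close> is only the allowance for the correction near
  the cone.\<close>

lemma classical_solution_exists:
  fixes p q A B R T \<epsilon> \<delta> N C :: real and a a' a'' b b' b'' :: "real \<Rightarrow> real"
  assumes p: "p > 1" and q: "q > 1" and A: "A > 0" and B: "B > 0" and R: "R > 0"
    and \<epsilon>: "\<epsilon> > 0" and T: "T > 0" and \<delta>: "\<delta> \<ge> 0" and N: "N = 2 * R * \<delta>"
    and a: "\<And>x. (a has_real_derivative a' x) (at x)" "\<And>x. (a' has_real_derivative a'' x) (at x)"
      "continuous_on UNIV a''" "\<And>x. \<bar>x\<bar> > R \<Longrightarrow> a x = 0"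
    and b: "\<And>x. (b has_real_derivative b' x) (at x)" "\<And>x. (b' has_real_derivative b'' x) (at x)"
      "continuous_on UNIV b''" "\<And>x. \<bar>x\<bar> > R \<Longrightarrow> b x = 0"
    and C: "\<And>h x. h \<in> {a, a', a'', b, b', b''} \<Longrightarrow> \<bar>h x\<bar> \<le> C"
    and strip: "T * \<delta> \<le> \<epsilon>" "A * (2 * C + \<epsilon>) powr p + B * (2 * C + 2 * R * \<epsilon>) powr q \<le> \<delta>"
    and interior: "T * (A * N powr p + B * (2 * T * N) powr q) \<le> N / 2"
  shows "\<exists>u. classical_solution p q A B (\<lambda>x. a x + b x) (\<lambda>x. a' x - b' x) T u"
proof -
  define \<phi> where "\<phi> = (\<lambda>s. A * \<bar>s\<bar> powr p)"
  define \<psi> where "\<psi> = (\<lambda>s. B * \<bar>s\<bar> powr q)"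
  define u0 where "u0 = (\<lambda>x t. a (x + t) + b (x - t))"
  define v0 where "v0 = (\<lambda>x t. a' (x + t) - b' (x - t))"
  define u0' where "u0' = (\<lambda>x t. a' (x + t) + b' (x - t))"
  define v0' where "v0' = (\<lambda>x t. a'' (x + t) - b'' (x - t))"
  note cont = DERIV_continuous_on_UNIV[OF a(1)] DERIV_continuous_on_UNIV[OF b(1)]
    DERIV_continuous_on_UNIV[OF a(2)] DERIV_continuous_on_UNIV[OF b(2)] a(3) b(3)
  have a'0: "a' x = 0" and b'0: "b' x = 0" if "\<bar>x\<bar> > R" for x
    using derivative_vanishes_outside[OF a(1,4) that] derivative_vanishes_outside[OF b(1,4) that]
    by simp_all
  have C0: "C \<ge> 0" using C[of a 0] by auto
  have two: "\<bar>h y + k z\<bar> \<le> 2 * C" "\<bar>h y - k z\<bar> \<le> 2 * C"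
    if "h \<in> {a, a', a'', b, b', b''}" "k \<in> {a, a', a'', b, b', b''}" for h k y z
    using C[OF that(1), of y] C[OF that(2), of z] by linarith+
  have free_bounds: "\<bar>u0 x t\<bar> \<le> 2 * C" "\<bar>v0 x t\<bar> \<le> 2 * C" "\<bar>u0' x t\<bar> \<le> 2 * C" "\<bar>v0' x t\<bar> \<le> 2 * C" for x t
    unfolding u0_def v0_def u0'_def v0'_def
    using two[of a b "x + t" "x - t"] two[of a' b' "x + t" "x - t"] two[of a'' b'' "x + t" "x - t"]
    by simp_all
  have huygens: "u0 x t = 0" "v0 x t = 0"
    if "t \<in> {0..T}" "t + R < \<bar>x\<bar> \<or> \<bar>x\<bar> < t - R" for x t
  proof -
    \<comment> \<open>Inside the cone too, both characteristics through the point meet the initial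
      line outside the supports of the profiles.\<close>
    have "\<bar>x + t\<bar> > R" "\<bar>x - t\<bar> > R" using that by auto
    then show "u0 x t = 0" "v0 x t = 0"
      by (simp_all add: u0_def v0_def a(4) b(4) a'0 b'0)
  qed
  have \<phi>: "\<phi> 0 = 0" "\<And>s r. \<bar>s\<bar> \<le> r \<Longrightarrow> 0 \<le> \<phi> s \<and> \<phi> s \<le> \<phi> r"
    using A p by (auto simp: \<phi>_def intro!: mult_left_mono powr_mono2)
  have \<psi>: "\<psi> 0 = 0" "\<And>s r. \<bar>s\<bar> \<le> r \<Longrightarrow> 0 \<le> \<psi> s \<and> \<psi> s \<le> \<psi> r"
    using B q by (auto simp: \<psi>_def intro!: mult_left_mono powr_mono2)
  have \<phi>': "(\<phi> has_real_derivative A * abs_powr_deriv p s) (at s)"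
    and \<psi>': "(\<psi> has_real_derivative B * abs_powr_deriv q s) (at s)" for s
    unfolding \<phi>_def \<psi>_def by (intro DERIV_cmult abs_powr_has_derivative p q)+
  have N0: "N \<ge> 0" using R \<delta> N by simp
  have strip': "\<phi> (2 * C + \<epsilon>) + \<psi> (2 * C + 2 * R * \<epsilon>) \<le> \<delta>"
    using strip(2) C0 \<epsilon> R by (simp add: \<phi>_def \<psi>_def)
  have interior': "T * (\<phi> N + \<psi> (2 * T * N)) \<le> N / 2"
    using interior N0 T by (simp add: \<phi>_def \<psi>_def)
  have free_cont: "strip_continuous T u0" "strip_continuous T v0"
    "strip_continuous T u0'" "strip_continuous T v0'"
    unfolding u0_def v0_def u0'_def v0'_def
    using strip_continuous_travelling_waves[OF cont(1,2)] strip_continuous_travelling_waves[OF cont(3,4)]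
      strip_continuous_travelling_waves[OF cont(5,6)] by simp_all
  have free_deriv: "has_x_derivative T u0 u0'" "has_x_derivative T v0 v0'"
    unfolding u0_def v0_def u0'_def v0'_def
    using travelling_waves(1)[OF a(1) b(1)] travelling_waves(3)[OF a(2) b(2)] .
  let ?F = "picard \<phi> \<psi> u0 v0" and ?\<kappa> = "\<phi> N + \<psi> (2 * T * N)"
  have cont_\<phi>\<psi>: "continuous_on UNIV \<phi>" "continuous_on UNIV \<psi>"
    using DERIV_continuous_on_UNIV[OF \<phi>'] DERIV_continuous_on_UNIV[OF \<psi>'] .
  have F_Suc: "?F (Suc n) = wave_source \<phi> \<psi> u0 v0 (?F n)" for n by (simp add: picard_def)
  have source_cont: "strip_continuous T (wave_source \<phi> \<psi> u0 v0 F)" if "strip_continuous T F" for F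
    by (rule strip_continuousI)
       (auto simp: wave_source_def intro!: continuous_intros continuous_on_compose2[OF cont_\<phi>\<psi>(1)]
          continuous_on_compose2[OF cont_\<phi>\<psi>(2)] free_cont[THEN strip_continuousD]
          strip_continuous_wave[OF that, THEN strip_continuousD]
          strip_continuous_wave_t[OF that, THEN strip_continuousD])
  note invariant = wave_source_cone_bounded[where \<phi> = \<phi> and \<psi> = \<psi> and ?u0.0 = u0 and ?v0.0 = v0 and N = N,
      OF _ _ R T \<delta> N \<phi> \<psi> free_bounds(1) huygens(1)
      free_bounds(2) huygens(2) strip(1) strip' interior']
  have inv: "strip_continuous T (?F n) \<and> cone_bounded T R \<delta> ?\<kappa> (?F n)" for n
  proof (induction n)
    case 0
    have "?\<kappa> \<ge> 0" using \<phi>(2)[of N N] \<psi>(2)[of "2 * T * N" "2 * T * N"] N0 T by simp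
    then show ?case using \<delta> by (simp add: picard_def strip_continuous_def cone_bounded_def)
  next
    case (Suc n)
    then show ?case unfolding F_Suc using source_cont invariant(3) by blast
  qed
  \<comment> \<open>The sum of all bounds on free part, strip and interior; only its independence of
    \<open>n\<close> matters.\<close>
  define M where "M = 2 * C + (\<epsilon> + 2 * R * \<epsilon>) + (N + 2 * T * N)"
  interpret bounded_picard T "2 * C" M \<phi> "\<lambda>s. A * abs_powr_deriv p s" \<psi> "\<lambda>s. B * abs_powr_deriv q s"
    u0 u0' v0 v0'
  proof
    fix n x t assume t: "t \<in> {0..T}"
    have "2 * R * \<epsilon> \<ge> 0" "2 * T * N \<ge> 0" using \<epsilon> R T N0 by simp_all
    note pos = this N0 \<epsilon>
    have bound: "0 \<le> H x t \<and> H x t \<le> d + d'"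
      if "cone_bounded T R d d' H" "d \<ge> 0" "d' \<ge> 0" for H d d'
      using cone_boundedD(1,3,4)[OF that(1) t, of x] that(2,3) by (cases "t - R \<le> \<bar>x\<bar>") auto
    show "\<bar>u0 x t + wave (?F n) x t\<bar> \<le> M"
      using bound[OF invariant(2)[of "?F n"]] inv[of n] free_bounds(1)[of x t] pos
      unfolding M_def by linarith
    show "\<bar>v0 x t + wave_t (?F n) x t\<bar> \<le> M"
      using bound[OF invariant(1)[of "?F n"]] inv[of n] free_bounds(2)[of x t] pos
      unfolding M_def by linarith
  qed (fact T \<phi>' \<psi>' free_cont free_deriv
      | rule free_bounds continuous_on_mult_left continuous_abs_powr_deriv p q)+
  obtain G G' where G: "strip_continuous T G" "strip_continuous T G'" "has_x_derivative T G G'"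
    "\<And>x t. t \<in> {0..T} \<Longrightarrow> G x t = wave_source \<phi> \<psi> u0 v0 G x t"
    using fixed_point by blast
  have "classical_solution p q A B (\<lambda>x. a x + b x) (\<lambda>x. a' x - b' x) T
    (\<lambda>x t. a (x + t) + b (x - t) + wave G x t)"
    by (rule classical_solution_from_source[OF T a(1-3) b(1-3) G(1-3)])
       (use G(4) in \<open>simp add: wave_source_def \<phi>_def \<psi>_def u0_def v0_def\<close>)
  then show ?thesis by blast
qed

theorem theorem2p2:
  fixes p q A B R :: real and f g :: "real \<Rightarrow> real"
  assumes "p > 1" and "q > 1" and "A > 0" and "B > 0" and "R \<ge> 1"
    and "C_k_compact_support 2 f" and "C_k_compact_support 1 g"
    and "supp f \<subseteq> {x. \<bar>x\<bar> \<le> R}" and "supp g \<subseteq> {x. \<bar>x\<bar> \<le> R}"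
    and "(LBINT x. g x) = 0"
  shows "\<exists>\<epsilon>2>0. \<exists>c>0. \<forall>\<epsilon>. 0 < \<epsilon> \<and> \<epsilon> \<le> \<epsilon>2 \<longrightarrow>
    (\<forall>T>0.
       (p \<le> (q + 1) / 2 \<longrightarrow> T \<le> c * \<epsilon> powr (- (p - 1))) \<and>
       ((q + 1) / 2 \<le> p \<and> p \<le> q \<longrightarrow> T \<le> c * \<epsilon> powr (- (p * (q - 1) / (q + 1)))) \<and>
       (p \<ge> q \<longrightarrow> T \<le> c * \<epsilon> powr (- (q * (q - 1) / (q + 1))))
       \<longrightarrow> (\<exists>u. classical_solution p q A B (\<lambda>x. \<epsilon> * f x) (\<lambda>x. \<epsilon> * g x) T u))"
proof -
  have R: "R > 0" "R \<ge> 0" using assms by auto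
  define m where "m = min p q"
  show ?thesis
  proof (rule travelling_profiles[OF assms(6,8,7,9) R(2) assms(10)])
    fix a a' a'' b b' b'' :: "real \<Rightarrow> real" and C :: real
    assume a: "\<And>x. (a has_real_derivative a' x) (at x)" "\<And>x. (a' has_real_derivative a'' x) (at x)"
        "continuous_on UNIV a''"
      and b: "\<And>x. (b has_real_derivative b' x) (at x)" "\<And>x. (b' has_real_derivative b'' x) (at x)"
        "continuous_on UNIV b''"
      and out: "\<And>x. \<bar>x\<bar> > R \<Longrightarrow> a x = 0" "\<And>x. \<bar>x\<bar> > R \<Longrightarrow> b x = 0"
      and fg: "\<And>x. a x + b x = f x" "\<And>x. a' x - b' x = g x"
      and C: "C > 0" "\<And>h x. h \<in> {a, a', a'', b, b', b''} \<Longrightarrow> \<bar>h x\<bar> \<le> C"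
    have two_C: "2 * C > 0" using C(1) by simp
    show ?thesis
    proof (rule lifespan_constants[OF assms(1-4) R(1) two_C, folded m_def])
      fix c K :: real
      assume c: "c > 0" and K: "K > 0" and small:
        "\<And>\<epsilon> T \<delta> N. 0 < \<epsilon> \<Longrightarrow> \<epsilon> \<le> 1 \<Longrightarrow> T > 0 \<Longrightarrow> \<delta> = K * \<epsilon> powr m \<Longrightarrow> N = 2 * R * \<delta> \<Longrightarrow>
          T * \<epsilon> powr (m - 1) \<le> c \<Longrightarrow> T * \<epsilon> powr (m * (q - 1) / (q + 1)) \<le> c \<Longrightarrow>
          T * \<delta> \<le> \<epsilon> \<and>
          A * (2 * C * \<epsilon> + \<epsilon>) powr p + B * (2 * C * \<epsilon> + 2 * R * \<epsilon>) powr q \<le> \<delta> \<and>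
          T * (A * N powr p + B * (2 * T * N) powr q) \<le> N / 2"
      have solution: "\<exists>u. classical_solution p q A B (\<lambda>x. \<epsilon> * f x) (\<lambda>x. \<epsilon> * g x) T u"
        if \<epsilon>: "0 < \<epsilon>" "\<epsilon> \<le> 1" and T: "T > 0"
          and life: "p \<le> (q + 1) / 2 \<longrightarrow> T \<le> c * \<epsilon> powr (- (p - 1))"
            "(q + 1) / 2 \<le> p \<and> p \<le> q \<longrightarrow> T \<le> c * \<epsilon> powr (- (p * (q - 1) / (q + 1)))"
            "p \<ge> q \<longrightarrow> T \<le> c * \<epsilon> powr (- (q * (q - 1) / (q + 1)))" for \<epsilon> T
      proof -
        define \<delta> where "\<delta> = K * \<epsilon> powr m"
        \<comment> \<open>In each regime \<open>r\<close> is the smaller of the two critical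
          exponents, so \<open>\<epsilon> \<le> 1\<close> yields both smallness conditions from one
          bound on \<open>T\<close>. For \<open>m = p\<close> they are equal exactly at
          \<open>p = (q + 1) / 2\<close>; for \<open>m = q\<close> the second is always
          smaller.\<close>
        obtain r where r: "T \<le> c * \<epsilon> powr (- r)" "r \<le> m - 1" "r \<le> m * (q - 1) / (q + 1)"
        proof -
          consider "p \<le> (q + 1) / 2" | "(q + 1) / 2 \<le> p" "p \<le> q" | "q \<le> p" by linarith
          then show ?thesis
          proof cases
            case 1
            then have "m = p" using assms(2) by (simp add: m_def field_simps)
            moreover have "p - 1 \<le> p * (q - 1) / (q + 1)" using 1 assms(2) by (simp add: field_simps)
            ultimately show ?thesis using that[of "p - 1"] life(1) 1 by simp
          next
            case 2
            then have "m = p" by (simp add: m_def)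
            moreover have "p * (q - 1) / (q + 1) \<le> p - 1" using 2 assms(2) by (simp add: field_simps)
            ultimately show ?thesis using that[of "p * (q - 1) / (q + 1)"] life(2) 2 by simp
          next
            case 3
            then have "m = q" by (simp add: m_def)
            moreover have "q * (q - 1) / (q + 1) \<le> q - 1" using assms(2) by (simp add: field_simps)
            ultimately show ?thesis using that[of "q * (q - 1) / (q + 1)"] life(3) 3 by simp
          qed
        qed
        have scaled: "T * \<epsilon> powr s \<le> c" if "r \<le> s" for s
        proof -
          have "T * \<epsilon> powr s \<le> (c * \<epsilon> powr (- r)) * \<epsilon> powr r"
            using r(1) that T \<epsilon> c by (intro mult_mono powr_mono') auto
          also have "\<dots> = c" using \<epsilon> by (simp add: powr_minus field_simps)
          finally show ?thesis .
        qed
        note smallness = small[OF \<epsilon> T \<delta>_def refl scaled[OF r(2)] scaled[OF r(3)]]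
        have bound: "\<bar>\<epsilon> * k x\<bar> \<le> C * \<epsilon>" if "k \<in> {a, a', a'', b, b', b''}" for k x
          using C(2)[OF that, of x] \<epsilon> by (simp add: abs_mult mult.commute)
        have "\<exists>u. classical_solution p q A B (\<lambda>x. \<epsilon> * a x + \<epsilon> * b x) (\<lambda>x. \<epsilon> * a' x - \<epsilon> * b' x) T u"
        \<comment> \<open>Scaling the profiles by \<open>\<epsilon>\<close> scales their bound to
          \<open>C * \<epsilon>\<close>, which matches \<open>small\<close> with
          \<open>2 * C\<close> in the place of \<open>E\<close>.\<close>
        proof (rule classical_solution_exists[where C = "C * \<epsilon>" and \<delta> = \<delta> and \<epsilon> = \<epsilon> and R = R
              and N = "2 * R * \<delta>"
              and a = "\<lambda>x. \<epsilon> * a x" and a' = "\<lambda>x. \<epsilon> * a' x" and a'' = "\<lambda>x. \<epsilon> * a'' x"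
              and b = "\<lambda>x. \<epsilon> * b x" and b' = "\<lambda>x. \<epsilon> * b' x" and b'' = "\<lambda>x. \<epsilon> * b'' x"])
          show "\<bar>h x\<bar> \<le> C * \<epsilon>"
            if "h \<in> {\<lambda>x. \<epsilon> * a x, \<lambda>x. \<epsilon> * a' x, \<lambda>x. \<epsilon> * a'' x, \<lambda>x. \<epsilon> * b x, \<lambda>x. \<epsilon> * b' x, \<lambda>x. \<epsilon> * b'' x}"
            for h x
            using that bound by (elim insertE emptyE) simp_all
          show "\<delta> \<ge> 0" using K by (simp add: \<delta>_def)
          show "\<epsilon> * a x = 0" "\<epsilon> * b x = 0" if "\<bar>x\<bar> > R" for x
            using out that by simp_all
          show "T * \<delta> \<le> \<epsilon>"
            "A * (2 * (C * \<epsilon>) + \<epsilon>) powr p + B * (2 * (C * \<epsilon>) + 2 * R * \<epsilon>) powr q \<le> \<delta>"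
            "T * (A * (2 * R * \<delta>) powr p + B * (2 * T * (2 * R * \<delta>)) powr q) \<le> 2 * R * \<delta> / 2"
            using smallness by (simp_all only: mult.assoc)
        qed (rule assms(1-4) R(1) \<epsilon>(1) T refl DERIV_cmult continuous_on_mult_left a b)+
        moreover have "(\<lambda>x. \<epsilon> * f x) = (\<lambda>x. \<epsilon> * a x + \<epsilon> * b x)"
          by (simp add: distrib_left flip: fg(1))
        moreover have "(\<lambda>x. \<epsilon> * g x) = (\<lambda>x. \<epsilon> * a' x - \<epsilon> * b' x)"
          by (simp add: right_diff_distrib flip: fg(2))
        ultimately show ?thesis by simp
      qed
      show ?thesis
        \<comment> \<open>\<open>\<epsilon>2 = 1\<close> suffices, since the constants only use
          \<open>\<epsilon> \<le> 1\<close>; \<open>c\<close> was fixed before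
          \<open>\<epsilon>\<close> and \<open>T\<close>.\<close>
        by (intro exI[of _ 1] exI[of _ c] conjI c zero_less_one allI impI)
           (rule solution; (elim conjE)?; assumption)
    qed
  qed
qed

end
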